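(* Let $P$ be an alcoved polytope with alcoved triangulation $\Delta$ and fix a simplex $F_0$ in $\Delta$. Let $G_\Delta$ be the dual graph of $\Delta$ and $D_\Delta(F_0)$ its orientation away from $F_0$. Then for every $k$, $$h_k^*(P)=\#\{F\in\Delta:\ F\text{ has exactly }k\text{ incoming arcs in }D_\Delta(F_0)\}.$$
   Context: For $l\in\mathbb{Z}$, $i,j\in\{0,\dots,n\}$ let $H_{i,j}^l=\{x\in\mathbb{R}^n:x_i-x_j=l\}$ with $x_0=0$; $\mathcal{A}_n$ is the arrangement of all such hyperplanes. A polytope $P$ is alcoved if all its facet-defining hyperplanes are of the form $H_{i,j}^l$ (so $P$ is a lattice polytope); $\mathcal{A}_n$ induces a triangulation $\Delta$ of $P$ into unimodular simplices, the alcoved triangulation. The dual graph $G_\Delta$ has vertex set $\Delta$ and an edge between two simplices whenever their intersection is a facet of both; $d$ denotes graph distance in $G_\Delta$. The orientation away from $F_0$, $D_\Delta(F_0)$, orients the edge between adjacent $F,F'$ as $F\to F'$ iff $d(F_0,F')=d(F_0,F)+1$ (and leaves it unoriented otherwise). For a lattice polytope $P$ of dimension $d$, with $L_P(t)=\#(tP\cap\mathbb{Z}^n)$, one writes $\sum_{t\ge0}L_P(t)z^t=\frac{h_0^*+h_1^*z+\dots+h_m^*z^m}{(1-z)^{d+1}}$; $(h_0^*,\dots,h_m^* )$ is the $h^*$-vector of $P$ (and $h^*_k=0$ for $k>m$). *)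

theory Defs
  imports
    "HOL-Analysis.Analysis"
    "HOL-Computational_Algebra.Formal_Power_Series"
begin

text \<open>The index set \<open>{0,...,n}\<close> is \<^typ>\<open>'n option\<close>, with \<^const>\<open>None\<close> in the role of \<open>0\<close>.\<close>

definition ext_coord :: "real ^ 'n \<Rightarrow> 'n option \<Rightarrow> real" where
  "ext_coord x i = (case i of None \<Rightarrow> 0 | Some m \<Rightarrow> x $ m)"

definition alcove_hyperplane :: "'n option \<Rightarrow> 'n option \<Rightarrow> int \<Rightarrow> (real ^ 'n) set" where
  "alcove_hyperplane i j l = {x. ext_coord x i - ext_coord x j = of_int l}"

text \<open>For \<open>i = j\<close> the defining equation does not describe a hyperplane.\<close>

definition alcove_arrangement :: "(real ^ 'n) set set" where
  "alcove_arrangement = {alcove_hyperplane i j l | i j l. i \<noteq> j}"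

definition facet_defining :: "'a::euclidean_space set \<Rightarrow> 'a set \<Rightarrow> bool" where
  "facet_defining P H \<longleftrightarrow>
     (\<exists>a b. a \<noteq> 0 \<and> H = {x. a \<bullet> x = b} \<and> P \<subseteq> {x. a \<bullet> x \<le> b} \<and> (P \<inter> H) facet_of P)"

text \<open>A facet of a polytope that is not full-dimensional is cut out by many hyperplanes, and only
  their traces on the affine hull are determined by the facet.  So facet-defining hyperplanes are
  compared inside the affine hull, and the affine hull itself has to be cut out by hyperplanes of
  the arrangement (without this, the segment from \<open>(0,0)\<close> to \<open>(1,2)\<close> would qualify, and so would
  every point).  For full-dimensional polytopes both provisos are void, see \<open>alcoved_full_dim\<close>.\<close>

definition alcoved :: "(real ^ 'n) set \<Rightarrow> bool" where
  "alcoved P \<longleftrightarrow> polytope P \<and>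
     (\<exists>\<H> \<subseteq> alcove_arrangement. affine hull P = \<Inter>\<H>) \<and>
     (\<forall>H. facet_defining P H \<longrightarrow>
        (\<exists>H' \<in> alcove_arrangement. affine hull P \<inter> H = affine hull P \<inter> H'))"

lemma alcoved_full_dim:
  fixes P :: "(real ^ 'n) set"
  assumes "aff_dim P = int CARD('n)"
  shows "alcoved P \<longleftrightarrow>
    polytope P \<and> (\<forall>H. facet_defining P H \<longrightarrow> H \<in> alcove_arrangement)"
proof -
  have hull: "affine hull P = UNIV"
    using assms aff_dim_eq_full[of P] by simp
  have "\<exists>\<H> \<subseteq> alcove_arrangement. (UNIV :: (real ^ 'n) set) = \<Inter>\<H>"
    by (rule exI[of _ "{}"]) simp
  then show ?thesis
    unfolding alcoved_def hull by auto
qed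

text \<open>The maximal simplices of the triangulation: closures of the regions into which the
  hyperplanes of the arrangement that do not contain \<open>P\<close> dissect \<open>P\<close>.\<close>

definition alcoved_triangulation :: "(real ^ 'n) set \<Rightarrow> (real ^ 'n) set set" where
  "alcoved_triangulation P =
     closure ` components (P - \<Union>{H \<in> alcove_arrangement. \<not> P \<subseteq> H})"

definition dual_graph :: "'a::euclidean_space set set \<Rightarrow> ('a set \<times> 'a set) set" where
  "dual_graph \<Delta> =
     {(F, F'). F \<in> \<Delta> \<and> F' \<in> \<Delta> \<and> (F \<inter> F') facet_of F \<and> (F \<inter> F') facet_of F'}"

definition graph_dist :: "('v \<times> 'v) set \<Rightarrow> 'v \<Rightarrow> 'v \<Rightarrow> nat" where
  "graph_dist E u v = (LEAST m. (u, v) \<in> E ^^ m)"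

definition orientation_away :: "('v \<times> 'v) set \<Rightarrow> 'v \<Rightarrow> ('v \<times> 'v) set" where
  "orientation_away E u = {(v, w) \<in> E. graph_dist E u w = graph_dist E u v + 1}"

definition incoming_arcs :: "('v \<times> 'v) set \<Rightarrow> 'v \<Rightarrow> ('v \<times> 'v) set" where
  "incoming_arcs D w = {a \<in> D. snd a = w}"

definition ehrhart_count :: "(real ^ 'n) set \<Rightarrow> nat \<Rightarrow> nat" where
  "ehrhart_count P t = card ((\<lambda>x. real t *\<^sub>R x) ` P \<inter> {x. \<forall>i. x $ i \<in> \<int>})"

definition ehrhart_series :: "(real ^ 'n) set \<Rightarrow> int fps" where
  "ehrhart_series P = Abs_fps (\<lambda>t. int (ehrhart_count P t))"

text \<open>The numerator of the Ehrhart series over the denominator \<open>(1 - z)^(d+1)\<close>.\<close>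

definition h_star :: "(real ^ 'n) set \<Rightarrow> nat \<Rightarrow> int" where
  "h_star P k = fps_nth (ehrhart_series P * (1 - fps_X) ^ (nat (aff_dim P) + 1)) k"

end

theory Submission
  imports Defs
begin

text \<open>
  An alcoved polytope is cut out by inequalities \<open>x\<^sub>i - x\<^sub>j \<le> l\<close> with integral \<open>l\<close>, so an alcove
  that meets it in a point off the hyperplanes lies entirely inside.  Two alcoves are adjacent iff
  exactly one hyperplane separates them, whence the distance in the dual graph is the number of
  separating hyperplanes.  Fix a generic point \<open>q\<close> of \<open>F\<^sub>0\<close> and remove from every simplex \<open>F\<close> the
  facets whose hyperplane separates \<open>F\<close> from \<open>q\<close>; these are the facets that carry an incoming arc.
  A point \<open>y\<close> of \<open>P\<close> belongs to the half-open \<open>F\<close> exactly if \<open>y + \<epsilon> (q - y)\<close> lies in \<open>F\<close> for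
  all small \<open>\<epsilon> > 0\<close>, so the half-open simplices partition \<open>P\<close>.  By unimodularity, one with \<open>k\<close>
  facets removed has the Ehrhart series \<open>z^k / (1 - z)^(d + 1)\<close>.
\<close>

section \<open>Integral half-spaces\<close>

definition coord_diff :: "real ^ 'n \<Rightarrow> 'n option \<Rightarrow> 'n option \<Rightarrow> real" where
  "coord_diff x i j = ext_coord x i - ext_coord x j"

definition ext_axis :: "'n option \<Rightarrow> real ^ 'n" where
  "ext_axis i = (case i of None \<Rightarrow> 0 | Some m \<Rightarrow> axis m 1)"

lemma ext_coord_None [simp]: "ext_coord x None = 0"
  by (simp add: ext_coord_def)

lemma ext_coord_Some [simp]: "ext_coord x (Some m) = x $ m"
  by (simp add: ext_coord_def)

lemma ext_coord_inner: "ext_coord x i = ext_axis i \<bullet> x"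
  by (cases i) (simp_all add: ext_axis_def inner_axis')

lemma coord_diff_inner: "coord_diff x i j = (ext_axis i - ext_axis j) \<bullet> x"
  by (simp add: coord_diff_def ext_coord_inner inner_diff_left)

lemma coord_diff_self [simp]: "coord_diff x i i = 0"
  by (simp add: coord_diff_def)

lemma coord_diff_swap: "coord_diff x j i = - coord_diff x i j"
  by (simp add: coord_diff_def)

lemma coord_diff_toward:
  "coord_diff (x + e *\<^sub>R (y - x)) i j = coord_diff x i j + e * (coord_diff y i j - coord_diff x i j)"
  by (simp add: coord_diff_inner inner_add_right inner_diff_right)

lemma continuous_on_coord_diff [continuous_intros]: "continuous_on S (\<lambda>x. coord_diff x i j)"
  unfolding coord_diff_inner by (intro continuous_intros)

lemma mem_alcove_hyperplane: "x \<in> alcove_hyperplane i j l \<longleftrightarrow> coord_diff x i j = of_int l"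
  by (simp add: alcove_hyperplane_def coord_diff_def)

lemma alcove_hyperplane_inner:
  "alcove_hyperplane i j l = {x. (ext_axis i - ext_axis j) \<bullet> x = of_int l}"
  by (auto simp: mem_alcove_hyperplane coord_diff_inner)

lemma between_not_Ints:
  fixes x :: real
  assumes "of_int l < x" "x < of_int l + 1"
  shows "x \<notin> \<int>"
proof
  assume "x \<in> \<int>"
  then obtain k where "x = of_int k" by (elim Ints_cases)
  with assms have "l < k" "k < l + 1" by linarith+
  then show False by simp
qed

lemma less_toward:
  fixes a b c e :: real
  assumes "c \<le> a" "c < b" "0 < e" "e \<le> 1"
  shows "c < a + e * (b - a)"
proof -
  have "0 \<le> (1 - e) * (a - c)" "0 < e * (b - c)"
    using assms by auto
  then show ?thesis
    by (simp add: algebra_simps)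
qed

lemma toward_less:
  fixes a b c e :: real
  assumes "a \<le> c" "b < c" "0 < e" "e \<le> 1"
  shows "a + e * (b - a) < c"
  using less_toward[of "- c" "- a" "- b" e] assms by (simp add: algebra_simps)

lemma proportional_on_affine:
  fixes a a' :: "'a::real_inner"
  assumes "affine A"
    and zeros: "\<And>x. x \<in> A \<Longrightarrow> a \<bullet> x = b \<longleftrightarrow> a' \<bullet> x = b'"
    and z: "z \<in> A" "a \<bullet> z = b" and p: "p \<in> A" "a \<bullet> p \<noteq> b"
  obtains k where "k \<noteq> 0" "\<forall>y\<in>A. a' \<bullet> y - b' = k * (a \<bullet> y - b)"
proof (rule that)
  have z': "a' \<bullet> z = b'" and "a' \<bullet> p \<noteq> b'"
    using zeros z p by auto
  then show "(a' \<bullet> p - b') / (a \<bullet> p - b) \<noteq> 0"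
    using p(2) by simp
  show "\<forall>y\<in>A. a' \<bullet> y - b' = (a' \<bullet> p - b') / (a \<bullet> p - b) * (a \<bullet> y - b)"
  proof
    fix y assume y: "y \<in> A"
    define s where "s = (a \<bullet> y - b) / (a \<bullet> p - b)"
    have "y + (- s) *\<^sub>R (p - z) \<in> A"
      by (rule mem_affine_3_minus[OF \<open>affine A\<close> y p(1) z(1)])
    moreover have "a \<bullet> (y + (- s) *\<^sub>R (p - z)) = b"
      using p(2) z(2) by (simp add: s_def inner_add_right inner_diff_right)
    ultimately have "a' \<bullet> (y + (- s) *\<^sub>R (p - z)) = b'"
      using zeros by blast
    then have "a' \<bullet> y - b' = s * (a' \<bullet> p - b')"
      by (simp add: z' inner_add_right inner_diff_right)
    then show "a' \<bullet> y - b' = (a' \<bullet> p - b') / (a \<bullet> p - b) * (a \<bullet> y - b)"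
      by (simp add: s_def)
  qed
qed

lemma alcoved_facet_proportional:
  fixes P :: "(real ^ 'n) set"
  assumes "alcoved P" and facet: "(P \<inter> {x. a \<bullet> x = b}) facet_of P"
    and a: "a \<noteq> 0" and le: "P \<subseteq> {x. a \<bullet> x \<le> b}"
  obtains i j and l :: int and k where "0 < k"
    "\<forall>x\<in>affine hull P. coord_diff x i j - l = k * (a \<bullet> x - b)"
proof -
  have "facet_defining P {x. a \<bullet> x = b}"
    unfolding facet_defining_def using a le facet by blast
  then obtain i j l
    where "affine hull P \<inter> {x. a \<bullet> x = b} = affine hull P \<inter> alcove_hyperplane i j l"
    using \<open>alcoved P\<close> by (auto simp: alcoved_def alcove_arrangement_def)
  then have zeros: "a \<bullet> x = b \<longleftrightarrow> (ext_axis i - ext_axis j) \<bullet> x = of_int l"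
    if "x \<in> affine hull P" for x
    using that by (auto simp: alcove_hyperplane_inner)
  obtain z where z: "z \<in> affine hull P" "a \<bullet> z = b"
    using facet hull_subset[of P affine] by (auto simp: facet_of_def)
  have "P \<inter> {x. a \<bullet> x = b} \<noteq> P"
    using facet by auto
  then obtain p where p: "p \<in> affine hull P" "a \<bullet> p \<noteq> b"
    using hull_subset[of P affine] by blast
  obtain k where k: "k \<noteq> 0"
    "\<forall>x\<in>affine hull P. coord_diff x i j - l = k * (a \<bullet> x - b)"
    unfolding coord_diff_inner by (rule proportional_on_affine[OF affine_affine_hull zeros z p])
  show ?thesis
  proof (cases "0 < k")
    case True
    then show ?thesis
      using k(2) by (rule that)
  next
    case False
    have "\<forall>x\<in>affine hull P. coord_diff x j i - of_int (- l) = - k * (a \<bullet> x - b)"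
      using k(2) by (auto simp: coord_diff_swap[of _ j i] algebra_simps)
    with False k(1) show ?thesis
      by (intro that[of "- k" j i "- l"]) auto
  qed
qed

lemma alcoved_facet_halfspace:
  fixes P :: "(real ^ 'n) set"
  assumes "alcoved P" and "(P \<inter> {x. a \<bullet> x = b}) facet_of P"
    and "a \<noteq> 0" and le: "P \<subseteq> {x. a \<bullet> x \<le> b}"
    and y: "y \<in> affine hull P"
    and valid: "\<And>i j l. (\<And>x. x \<in> P \<Longrightarrow> coord_diff x i j \<le> of_int l) \<Longrightarrow>
      coord_diff y i j \<le> of_int l"
  shows "a \<bullet> y \<le> b"
proof -
  obtain i j and l :: int and k where k: "0 < k"
    "\<forall>x\<in>affine hull P. coord_diff x i j - l = k * (a \<bullet> x - b)"
    by (rule alcoved_facet_proportional[OF assms(1-4)])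
  have "coord_diff x i j \<le> l" if "x \<in> P" for x
  proof -
    have "k * (a \<bullet> x - b) \<le> 0"
      using le that k(1) by (intro mult_nonneg_nonpos) auto
    with bspec[OF k(2) hull_inc[OF that]] show ?thesis by linarith
  qed
  then have "coord_diff y i j \<le> l"
    by (rule valid)
  with bspec[OF k(2) y] have "k * (a \<bullet> y - b) \<le> 0"
    by linarith
  with k(1) show ?thesis
    by (simp add: mult_le_0_iff)
qed

lemma alcoved_affine_hullI:
  fixes P :: "(real ^ 'n) set"
  assumes "alcoved P"
    and valid: "\<And>i j l. (\<And>x. x \<in> P \<Longrightarrow> coord_diff x i j \<le> of_int l) \<Longrightarrow>
      coord_diff y i j \<le> of_int l"
  shows "y \<in> affine hull P"
proof -
  obtain \<H> where \<H>: "\<H> \<subseteq> alcove_arrangement" "affine hull P = \<Inter>\<H>"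
    using assms(1) by (auto simp: alcoved_def)
  have "y \<in> H" if mem: "H \<in> \<H>" for H
  proof -
    obtain i j l where H: "H = alcove_hyperplane i j l"
      using \<H>(1) mem by (auto simp: alcove_arrangement_def)
    have "P \<subseteq> H"
      using \<H>(2) mem hull_subset[of P affine] by blast
    then have eq: "coord_diff x i j = l" if "x \<in> P" for x
      using that by (auto simp: H mem_alcove_hyperplane)
    have "coord_diff y i j \<le> l" "coord_diff y j i \<le> of_int (- l)"
      by (rule valid; simp add: eq coord_diff_swap[of _ j i])+
    then show ?thesis
      by (simp add: H mem_alcove_hyperplane coord_diff_swap[of _ j i])
  qed
  with \<H>(2) show ?thesis by blast
qed

lemma alcoved_halfspaces:
  fixes P :: "(real ^ 'n) set"
  assumes "alcoved P"
    and valid: "\<And>i j l. (\<And>x. x \<in> P \<Longrightarrow> coord_diff x i j \<le> of_int l) \<Longrightarrow>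
      coord_diff y i j \<le> of_int l"
  shows "y \<in> P"
proof -
  have y: "y \<in> affine hull P"
    using assms by (rule alcoved_affine_hullI)
  have "polyhedron P"
    using assms(1) polytope_imp_polyhedron by (auto simp: alcoved_def)
  then obtain \<F> where \<F>: "finite \<F>" "P = affine hull P \<inter> \<Inter>\<F>"
      "\<forall>h\<in>\<F>. \<exists>a b. a \<noteq> 0 \<and> h = {x. a \<bullet> x \<le> b}"
      "\<forall>\<F>'. \<F>' \<subset> \<F> \<longrightarrow> P \<subset> affine hull P \<inter> \<Inter>\<F>'"
    unfolding polyhedron_Int_affine_minimal by blast
  then obtain a b where ab: "\<And>h. h \<in> \<F> \<Longrightarrow> a h \<noteq> 0 \<and> h = {x. a h \<bullet> x \<le> b h}"
    by metis
  have "y \<in> h" if "h \<in> \<F>" for h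
  proof -
    have facet: "(P \<inter> {x. a h \<bullet> x = b h}) facet_of P"
      using facet_of_polyhedron_explicit[of \<F> P a b, OF \<F>(1,2) ab] \<F>(4) that by blast
    have le: "P \<subseteq> {x. a h \<bullet> x \<le> b h}"
      using \<F>(2) ab[OF that] that by blast
    have "a h \<bullet> y \<le> b h"
      using alcoved_facet_halfspace[OF assms(1) facet _ le y] ab[OF that] valid by blast
    with ab[OF that] show ?thesis by blast
  qed
  with y \<F>(2) show ?thesis by blast
qed

section \<open>The alcoved triangulation\<close>

abbreviation level :: "real ^ 'n \<Rightarrow> 'n option \<Rightarrow> 'n option \<Rightarrow> int" where
  "level x i j \<equiv> \<lfloor>coord_diff x i j\<rfloor>"

locale alcoved_polytope =
  fixes P :: "(real ^ 'n) set"
  assumes alcoved: "alcoved P"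
    and nonempty: "P \<noteq> {}"
begin

lemma polytope: "polytope P"
  using alcoved by (simp add: alcoved_def)

definition tied :: "'n option \<Rightarrow> 'n option \<Rightarrow> bool" where
  "tied i j \<longleftrightarrow> (\<exists>l::int. \<forall>x\<in>P. coord_diff x i j = l)"

lemma tied_eq: "tied i j \<Longrightarrow> x \<in> P \<Longrightarrow> y \<in> P \<Longrightarrow> coord_diff x i j = coord_diff y i j"
  by (auto simp: tied_def)

lemma tied_refl: "tied i i"
  by (auto simp: tied_def intro: exI[of _ 0])

lemma tied_sym: "tied i j \<Longrightarrow> tied j i"
  unfolding tied_def by (metis coord_diff_swap of_int_minus)

lemma tied_trans: "tied i j \<Longrightarrow> tied j k \<Longrightarrow> tied i k"
proof -
  have "coord_diff x i k = coord_diff x i j + coord_diff x j k" for x :: "real ^ 'n"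
    by (simp add: coord_diff_def)
  then show "tied i j \<Longrightarrow> tied j k \<Longrightarrow> tied i k"
    unfolding tied_def by (metis of_int_add)
qed

text \<open>In a polytope that is not full-dimensional, only one index of each class of tied indices
  matters; the index \<^const>\<open>None\<close> represents its own class.\<close>

definition rep :: "'n option \<Rightarrow> 'n option" where
  "rep i = (if tied i None then None else SOME j. tied i j)"

definition reps :: "'n option set" where
  "reps = range rep"

lemma tied_rep: "tied i (rep i)"
  unfolding rep_def by (auto intro: someI[of "tied i", OF tied_refl])

lemma rep_eq_iff: "rep i = rep j \<longleftrightarrow> tied i j"
proof
  assume "rep i = rep j"
  then show "tied i j"
    using tied_rep[of i] tied_rep[of j] tied_sym tied_trans by metis
next
  assume "tied i j"
  then have "tied i = tied j"
    using tied_sym tied_trans by blast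
  then show "rep i = rep j" by (simp add: rep_def)
qed

lemma rep_None [simp]: "rep None = None"
  by (simp add: rep_def tied_refl)

lemma rep_in_reps [simp]: "rep i \<in> reps"
  by (simp add: reps_def)

lemma rep_of_reps [simp]: "i \<in> reps \<Longrightarrow> rep i = i"
  using rep_eq_iff tied_rep tied_sym by (auto simp: reps_def)

lemma None_in_reps [simp]: "None \<in> reps"
  by (metis rep_None rep_in_reps)

lemma card_reps_pos [simp]: "0 < card reps"
  using None_in_reps by (metis card_gt_0_iff empty_iff finite)

lemma reps_untied: "i \<in> reps \<Longrightarrow> j \<in> reps \<Longrightarrow> i \<noteq> j \<Longrightarrow> \<not> tied i j"
  by (metis rep_eq_iff rep_of_reps)

definition flat :: "(real ^ 'n) set" where
  "flat = {y. \<forall>i j. tied i j \<longrightarrow> (\<forall>x\<in>P. coord_diff y i j = coord_diff x i j)}"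

lemma P_subset_flat: "P \<subseteq> flat"
  unfolding flat_def using tied_eq by blast

lemma affine_flat: "affine flat"
proof -
  have "flat = (\<Inter>i. \<Inter>j\<in>{j. tied i j}. \<Inter>x\<in>P. {y. (ext_axis i - ext_axis j) \<bullet> y = coord_diff x i j})"
    by (auto simp: flat_def coord_diff_inner)
  then show ?thesis
    by (auto intro!: affine_Inter affine_hyperplane)
qed

lemma closed_flat: "closed flat"
  using closed_affine_hull[of flat] affine_flat by (metis affine_hull_eq)

lemma toward_in_flat: "x \<in> flat \<Longrightarrow> y \<in> flat \<Longrightarrow> x + e *\<^sub>R (y - x) \<in> flat"
  using mem_affine_3_minus[OF affine_flat] by blast

lemma flat_coord_diff_rep:
  "\<exists>c::int. \<forall>y\<in>flat. coord_diff y i j = coord_diff y (rep i) (rep j) + c"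
proof -
  obtain a b where ab: "\<And>x. x \<in> P \<Longrightarrow> coord_diff x i (rep i) = of_int a"
      "\<And>x. x \<in> P \<Longrightarrow> coord_diff x j (rep j) = of_int b"
    using tied_rep[of i] tied_rep[of j] by (auto simp: tied_def)
  have "coord_diff y i j = coord_diff y (rep i) (rep j) + of_int (a - b)" if "y \<in> flat" for y
  proof -
    have "coord_diff y i (rep i) = of_int a" "coord_diff y j (rep j) = of_int b"
      using that nonempty ab tied_rep by (auto simp: flat_def)
    then show ?thesis by (simp add: coord_diff_def)
  qed
  then show ?thesis by blast
qed

lemma flat_coord_diff_tied:
  "x \<in> flat \<Longrightarrow> y \<in> flat \<Longrightarrow> tied i j \<Longrightarrow> coord_diff x i j = coord_diff y i j"
  using nonempty by (auto simp: flat_def)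

lemma ex_flat_point:
  fixes g :: "'n option \<Rightarrow> real"
  obtains y where "y \<in> flat" "\<And>i. i \<in> reps \<Longrightarrow> ext_coord y i = g i - g None"
proof -
  obtain x where "x \<in> P"
    using nonempty by blast
  define y :: "real ^ 'n" where
    "y = (\<chi> m. g (rep (Some m)) - g None + coord_diff x (Some m) (rep (Some m)))"
  have y: "ext_coord y i = g (rep i) - g None + coord_diff x i (rep i)" for i
    by (cases i) (simp_all add: y_def)
  have "coord_diff y i j = coord_diff x' i j" if "x' \<in> P" "tied i j" for i j x'
  proof -
    have "rep i = rep j"
      using that(2) by (simp add: rep_eq_iff)
    then have "coord_diff y i j = coord_diff x i j"
      by (simp add: y coord_diff_def)
    also have "\<dots> = coord_diff x' i j"
      by (rule tied_eq[OF that(2) \<open>x \<in> P\<close> that(1)])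
    finally show ?thesis .
  qed
  then have "y \<in> flat" by (simp add: flat_def)
  then show ?thesis
    by (rule that) (simp add: y)
qed

lemma mem_P_if_reps_halfspaces:
  assumes y: "y \<in> flat"
    and valid: "\<And>i j l. i \<in> reps \<Longrightarrow> j \<in> reps \<Longrightarrow> i \<noteq> j \<Longrightarrow>
      (\<And>x. x \<in> P \<Longrightarrow> coord_diff x i j \<le> of_int l) \<Longrightarrow> coord_diff y i j \<le> of_int l"
  shows "y \<in> P"
proof (rule alcoved_halfspaces[OF alcoved])
  fix i j l assume le: "\<And>x. x \<in> P \<Longrightarrow> coord_diff x i j \<le> of_int l"
  show "coord_diff y i j \<le> of_int l"
  proof (cases "tied i j")
    case True
    obtain x where "x \<in> P"
      using nonempty by blast
    with le[of x] flat_coord_diff_tied[OF y _ True, of x] P_subset_flat show ?thesis by auto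
  next
    case False
    obtain c :: int where c: "\<And>y. y \<in> flat \<Longrightarrow> coord_diff y i j = coord_diff y (rep i) (rep j) + c"
      using flat_coord_diff_rep[of i j] by blast
    have "coord_diff x (rep i) (rep j) \<le> of_int (l - c)" if "x \<in> P" for x
      using le[OF that] c[of x] P_subset_flat that by auto
    then have "coord_diff y (rep i) (rep j) \<le> of_int (l - c)"
      using False by (intro valid) (simp_all add: rep_eq_iff)
    with c[OF y] show ?thesis by simp
  qed
qed

definition generic :: "(real ^ 'n) set" where
  "generic = P - \<Union>{H \<in> alcove_arrangement. \<not> P \<subseteq> H}"

lemma generic_iff:
  "x \<in> generic \<longleftrightarrow> x \<in> P \<and> (\<forall>i\<in>reps. \<forall>j\<in>reps. i \<noteq> j \<longrightarrow> coord_diff x i j \<notin> \<int>)"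
proof (intro iffI conjI ballI impI)
  assume x: "x \<in> generic"
  show "x \<in> P"
    using x by (simp add: generic_def)
  fix i j assume ij: "i \<in> reps" "j \<in> reps" "i \<noteq> j"
  show "coord_diff x i j \<notin> \<int>"
  proof
    assume "coord_diff x i j \<in> \<int>"
    then obtain l where "x \<in> alcove_hyperplane i j l"
      by (auto simp: mem_alcove_hyperplane elim: Ints_cases)
    moreover have "alcove_hyperplane i j l \<in> alcove_arrangement"
      using ij(3) by (auto simp: alcove_arrangement_def)
    ultimately have "P \<subseteq> alcove_hyperplane i j l"
      using x by (auto simp: generic_def)
    then have "tied i j"
      unfolding tied_def by (intro exI[of _ l]) (auto simp: mem_alcove_hyperplane)
    with reps_untied[OF ij] show False ..
  qed
next
  assume x: "x \<in> P \<and> (\<forall>i\<in>reps. \<forall>j\<in>reps. i \<noteq> j \<longrightarrow> coord_diff x i j \<notin> \<int>)"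
  have "P \<subseteq> H" if mem: "H \<in> alcove_arrangement" "x \<in> H" for H
  proof -
    obtain i j l where H: "H = alcove_hyperplane i j l"
      using mem(1) by (auto simp: alcove_arrangement_def)
    with mem(2) have xl: "coord_diff x i j = of_int l"
      by (simp add: mem_alcove_hyperplane)
    obtain c :: int where "coord_diff x i j = coord_diff x (rep i) (rep j) + c"
      using flat_coord_diff_rep[of i j] x P_subset_flat by blast
    with xl have "coord_diff x (rep i) (rep j) = of_int (l - c)"
      by simp
    then have "rep i = rep j"
      using x by (metis Ints_of_int rep_in_reps)
    then have "coord_diff y i j = of_int l" if "y \<in> P" for y
      using tied_eq[of i j y x] that x xl by (simp add: rep_eq_iff)
    then show ?thesis
      by (auto simp: H mem_alcove_hyperplane)
  qed
  with x show "x \<in> generic"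
    by (auto simp: generic_def)
qed

lemma generic_in_P: "x \<in> generic \<Longrightarrow> x \<in> P"
  by (simp add: generic_iff)

lemma generic_in_flat: "x \<in> generic \<Longrightarrow> x \<in> flat"
  using generic_in_P P_subset_flat by blast

lemma
  assumes "x \<in> generic" "i \<in> reps" "j \<in> reps" "i \<noteq> j"
  shows level_less: "of_int (level x i j) < coord_diff x i j"
    and level_swap: "level x j i = - level x i j - 1"
proof -
  have "coord_diff x i j \<notin> \<int>"
    using assms by (simp add: generic_iff)
  then show "of_int (level x i j) < coord_diff x i j"
    by (metis Ints_of_int floor_correct less_le)
  then show "level x j i = - level x i j - 1"
    unfolding coord_diff_swap[of x j i] by linarith
qed

definition alcove :: "real ^ 'n \<Rightarrow> (real ^ 'n) set" where
  "alcove x = {y \<in> flat. \<forall>i\<in>reps. \<forall>j\<in>reps. i \<noteq> j \<longrightarrow>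
    of_int (level x i j) < coord_diff y i j \<and> coord_diff y i j < of_int (level x i j) + 1}"

definition closed_alcove :: "real ^ 'n \<Rightarrow> (real ^ 'n) set" where
  "closed_alcove x = {y \<in> flat. \<forall>i\<in>reps. \<forall>j\<in>reps.
    of_int (level x i j) \<le> coord_diff y i j \<and> coord_diff y i j \<le> of_int (level x i j) + 1}"

lemma closed_alcoveI:
  assumes "y \<in> flat"
    and "\<And>i j. i \<in> reps \<Longrightarrow> j \<in> reps \<Longrightarrow> i \<noteq> j \<Longrightarrow> of_int (level x i j) \<le> coord_diff y i j"
    and "\<And>i j. i \<in> reps \<Longrightarrow> j \<in> reps \<Longrightarrow> i \<noteq> j \<Longrightarrow> coord_diff y i j \<le> of_int (level x i j) + 1"
  shows "y \<in> closed_alcove x"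
proof -
  have "of_int (level x i j) \<le> coord_diff y i j \<and> coord_diff y i j \<le> of_int (level x i j) + 1"
    if "i \<in> reps" "j \<in> reps" for i j
    using assms that by (cases "i = j") simp_all
  with assms(1) show ?thesis
    by (simp add: closed_alcove_def)
qed

lemma
  assumes "y \<in> closed_alcove x" "i \<in> reps" "j \<in> reps"
  shows closed_alcove_lower: "of_int (level x i j) \<le> coord_diff y i j"
    and closed_alcove_upper: "coord_diff y i j \<le> of_int (level x i j) + 1"
  using assms by (auto simp: closed_alcove_def)

lemma closed_alcove_subset_flat: "closed_alcove x \<subseteq> flat"
  by (auto simp: closed_alcove_def)

lemma alcove_subset_closed_alcove: "alcove x \<subseteq> closed_alcove x"
  by (auto simp: alcove_def less_imp_le intro!: closed_alcoveI)

lemma mem_alcove_self: "x \<in> generic \<Longrightarrow> x \<in> alcove x"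
  by (auto simp: alcove_def generic_in_flat level_less)

lemma mem_closed_alcove_self: "x \<in> generic \<Longrightarrow> x \<in> closed_alcove x"
  using mem_alcove_self alcove_subset_closed_alcove by blast

lemma closed_alcove_subset:
  assumes x: "x \<in> generic"
  shows "closed_alcove x \<subseteq> P"
proof
  fix y assume y: "y \<in> closed_alcove x"
  show "y \<in> P"
  proof (rule mem_P_if_reps_halfspaces)
    show "y \<in> flat"
      using y closed_alcove_subset_flat by blast
    fix i j l assume ij: "i \<in> reps" "j \<in> reps" "i \<noteq> j"
      and le: "\<And>x. x \<in> P \<Longrightarrow> coord_diff x i j \<le> of_int l"
    have "level x i j < l"
      using level_less[OF x ij] le[OF generic_in_P[OF x]] by linarith
    then have "real_of_int (level x i j) + 1 \<le> of_int l"
      by linarith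
    with closed_alcove_upper[OF y ij(1,2)] show "coord_diff y i j \<le> of_int l"
      by linarith
  qed
qed

lemma alcove_subset_generic:
  assumes "x \<in> generic"
  shows "alcove x \<subseteq> generic"
proof
  fix y assume y: "y \<in> alcove x"
  have "coord_diff y i j \<notin> \<int>" if "i \<in> reps" "j \<in> reps" "i \<noteq> j" for i j
    using y that between_not_Ints[of "level x i j"] by (simp add: alcove_def)
  then show "y \<in> generic"
    using y closed_alcove_subset[OF assms] alcove_subset_closed_alcove
    unfolding generic_iff by blast
qed

lemma closed_alcove_cong:
  "(\<And>i j. i \<in> reps \<Longrightarrow> j \<in> reps \<Longrightarrow> level x i j = level y i j) \<Longrightarrow>
    closed_alcove x = closed_alcove y"
  by (simp add: closed_alcove_def)

lemma generic_closed_alcove_level: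
  assumes x: "x \<in> generic" and y: "y \<in> generic" "y \<in> closed_alcove x" and ij: "i \<in> reps" "j \<in> reps"
  shows "level y i j = level x i j"
proof (cases "i = j")
  case False
  have "coord_diff y i j \<noteq> of_int (level x i j + 1)"
    using y(1) ij False by (metis generic_iff Ints_of_int)
  with closed_alcove_lower[OF y(2) ij] closed_alcove_upper[OF y(2) ij] show ?thesis
    by linarith
qed simp

lemma generic_closed_alcove_eq:
  assumes "x \<in> generic" "y \<in> generic" "y \<in> closed_alcove x"
  shows "closed_alcove y = closed_alcove x"
  by (intro closed_alcove_cong generic_closed_alcove_level assms)

lemma closed_alcove_eqD:
  assumes "x \<in> generic" "y \<in> generic" "closed_alcove x = closed_alcove y" "i \<in> reps" "j \<in> reps"
  shows "level x i j = level y i j"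
  using assms generic_closed_alcove_level mem_closed_alcove_self by metis

lemma alcove_eq_closed_alcove_Int:
  assumes x: "x \<in> generic"
  shows "alcove x = closed_alcove x \<inter> generic"
proof
  show "closed_alcove x \<inter> generic \<subseteq> alcove x"
  proof
    fix y assume y: "y \<in> closed_alcove x \<inter> generic"
    then have "alcove y = alcove x"
      using generic_closed_alcove_level[OF x, of y] by (simp add: alcove_def)
    with y mem_alcove_self show "y \<in> alcove x" by blast
  qed
qed (use alcove_subset_generic[OF x] alcove_subset_closed_alcove in blast)

lemma
  shows convex_closed_alcove: "convex (closed_alcove x)"
    and closed_closed_alcove: "closed (closed_alcove x)"
proof -
  have eq: "closed_alcove x = flat \<inter> (\<Inter>i\<in>reps. \<Inter>j\<in>reps.
      {y. (ext_axis i - ext_axis j) \<bullet> y \<ge> level x i j} \<inter>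
      {y. (ext_axis i - ext_axis j) \<bullet> y \<le> level x i j + 1})"
    by (auto simp: closed_alcove_def coord_diff_inner)
  show "convex (closed_alcove x)" unfolding eq
    by (intro convex_Int convex_INT affine_imp_convex affine_flat convex_halfspace_le
        convex_halfspace_ge)
  show "closed (closed_alcove x)" unfolding eq
    by (intro closed_Int closed_INT ballI closed_flat closed_halfspace_le closed_halfspace_ge)
qed

lemma alcove_eq_halfspaces:
  "alcove x = flat \<inter> (\<Inter>i\<in>reps. \<Inter>j\<in>reps - {i}.
    {y. (ext_axis i - ext_axis j) \<bullet> y > level x i j} \<inter>
    {y. (ext_axis i - ext_axis j) \<bullet> y < level x i j + 1})"
  by (auto simp: alcove_def coord_diff_inner)

lemma convex_alcove: "convex (alcove x)"
  unfolding alcove_eq_halfspaces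
  by (intro convex_Int convex_INT affine_imp_convex affine_flat convex_halfspace_lt
      convex_halfspace_gt)

lemma openin_alcove: "openin (top_of_set flat) (alcove x)"
  unfolding alcove_eq_halfspaces
  by (intro openin_open_Int open_INT ballI finite open_Int open_halfspace_lt open_halfspace_gt)

lemma closure_alcove:
  assumes x: "x \<in> generic"
  shows "closure (alcove x) = closed_alcove x"
proof
  show "closure (alcove x) \<subseteq> closed_alcove x"
    by (rule closure_minimal[OF alcove_subset_closed_alcove closed_closed_alcove])
  show "closed_alcove x \<subseteq> closure (alcove x)"
  proof
    fix y assume y: "y \<in> closed_alcove x"
    have "y + e *\<^sub>R (x - y) \<in> alcove x" if e: "0 < e" "e < 1" for e
    proof -
      have "y + e *\<^sub>R (x - y) \<in> flat"
        using y closed_alcove_subset_flat generic_in_flat[OF x] by (blast intro: toward_in_flat)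
      then show ?thesis
        using e level_less[OF x] closed_alcove_lower[OF y] closed_alcove_upper[OF y]
        by (simp add: alcove_def coord_diff_toward less_toward toward_less)
    qed
    then have "open_segment y x \<subseteq> alcove x"
      by (auto simp: open_segment_image_interval algebra_simps split: if_splits)
    then have "closure (open_segment y x) \<subseteq> closure (alcove x)"
      by (rule closure_mono)
    then show "y \<in> closure (alcove x)"
      using mem_alcove_self[OF x] closure_subset by (cases "x = y") auto
  qed
qed

lemma connected_component_generic:
  assumes x: "x \<in> generic"
  shows "connected_component_set generic x = alcove x"
proof
  show "alcove x \<subseteq> connected_component_set generic x"
    using mem_alcove_self[OF x] convex_connected[OF convex_alcove] alcove_subset_generic[OF x]
    by (rule connected_component_maximal)
  let ?C = "connected_component_set generic x"
  have C: "?C \<subseteq> generic"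
    by (rule connected_component_subset)
  have "openin (top_of_set ?C) (?C \<inter> alcove x)"
    using openin_alcove[of x] C generic_in_flat unfolding openin_open by blast
  moreover have "?C \<inter> alcove x = ?C \<inter> closed_alcove x"
    using C alcove_eq_closed_alcove_Int[OF x] by blast
  then have "closedin (top_of_set ?C) (?C \<inter> alcove x)"
    using closed_closed_alcove by (simp add: closedin_closed_Int)
  ultimately have "?C \<inter> alcove x = {} \<or> ?C \<inter> alcove x = ?C"
    using connected_connected_component connected_clopen by blast
  moreover have "x \<in> ?C \<inter> alcove x"
    using x mem_alcove_self by simp
  ultimately show "?C \<subseteq> alcove x" by blast
qed

lemma alcoved_triangulation_eq: "alcoved_triangulation P = closed_alcove ` generic"
proof -
  have "components generic = alcove ` generic"
    unfolding components_def by (rule image_cong) (simp_all add: connected_component_generic)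
  then show ?thesis
    unfolding alcoved_triangulation_def generic_def[symmetric]
    by (simp add: image_image closure_alcove)
qed

lemma finite_alcoved_triangulation: "finite (closed_alcove ` generic)"
proof -
  define levels where "levels = (\<lambda>(x::real ^ 'n) (i, j). level x i j)"
  have "finite ((\<lambda>x. levels x p) ` P)" for p
  proof (cases p)
    case (Pair i j)
    have "bounded ((\<lambda>x. coord_diff x i j) ` P)"
      using polytope_imp_compact[OF polytope]
      by (intro compact_imp_bounded compact_continuous_image continuous_intros)
    then obtain B where B: "\<And>x. x \<in> P \<Longrightarrow> \<bar>coord_diff x i j\<bar> \<le> B"
      by (auto simp: bounded_iff)
    have "levels x p \<in> {\<lfloor>- B\<rfloor>..\<lfloor>B\<rfloor>}" if "x \<in> P" for x
      using B[OF that] by (simp add: levels_def Pair floor_mono)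
    then show ?thesis
      by (meson finite_atLeastAtMost_int finite_subset image_subsetI)
  qed
  then have "finite (\<Pi>\<^sub>E p\<in>UNIV. (\<lambda>x. levels x p) ` P)"
    by (intro finite_PiE) auto
  moreover have "levels ` generic \<subseteq> (\<Pi>\<^sub>E p\<in>UNIV. (\<lambda>x. levels x p) ` P)"
    using generic_in_P by auto
  ultimately have "finite (levels ` generic)"
    by (rule finite_subset[rotated])
  moreover have "closed_alcove x = closed_alcove y" if "levels x = levels y" for x y
    using that by (intro closed_alcove_cong) (simp add: levels_def fun_eq_iff)
  then obtain g where "closed_alcove = g \<circ> levels"
    using function_factors_left[of levels closed_alcove] by blast
  ultimately show ?thesis
    by (metis finite_imageI image_comp)
qed

definition tied_space :: "(real ^ 'n) set" where
  "tied_space = {z. \<forall>i. ext_coord z i = ext_coord z (rep i)}"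

lemma flat_translation:
  assumes p: "p \<in> flat"
  shows "(\<lambda>y. y - p) ` flat = tied_space"
proof (intro set_eqI iffI)
  fix z assume "z \<in> (\<lambda>y. y - p) ` flat"
  then obtain y where y: "y \<in> flat" "z = y - p" by blast
  have "coord_diff z i (rep i) = 0" for i
    using flat_coord_diff_tied[OF y(1) p tied_rep]
    by (simp add: y(2) coord_diff_inner inner_diff_right)
  then show "z \<in> tied_space"
    by (simp add: tied_space_def coord_diff_def)
next
  fix z assume z: "z \<in> tied_space"
  have "coord_diff (p + z) i j = coord_diff p i j" if "tied i j" for i j
  proof -
    have "rep i = rep j"
      using that by (simp add: rep_eq_iff)
    moreover have "ext_coord z i = ext_coord z (rep i)" "ext_coord z j = ext_coord z (rep j)"
      using z by (simp_all add: tied_space_def)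
    ultimately have "coord_diff z i j = 0"
      by (simp add: coord_diff_def)
    then show ?thesis
      by (simp add: coord_diff_inner inner_add_right)
  qed
  then have "p + z \<in> flat"
    using p by (simp add: flat_def)
  then show "z \<in> (\<lambda>y. y - p) ` flat"
    by (intro image_eqI[of _ _ "p + z"]) simp_all
qed

definition spread :: "real ^ 'n \<Rightarrow> real ^ 'n" where
  "spread z = (\<chi> m. ext_coord z (rep (Some m)))"

lemma ext_coord_spread: "ext_coord (spread z) i = ext_coord z (rep i)"
  by (cases i) (simp_all add: spread_def)

lemma linear_spread: "linear spread"
  by (intro linearI) (simp_all add: spread_def vec_eq_iff ext_coord_inner inner_add_right)

lemma inj_on_spread: "inj_on spread {z. \<forall>m. Some m \<notin> reps \<longrightarrow> z $ m = 0}"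
proof (rule inj_onI)
  fix z w assume zw: "z \<in> {z. \<forall>m. Some m \<notin> reps \<longrightarrow> z $ m = 0}"
    "w \<in> {z. \<forall>m. Some m \<notin> reps \<longrightarrow> z $ m = 0}" "spread z = spread w"
  have "z $ m = w $ m" for m
    using zw ext_coord_spread[of z "Some m"] ext_coord_spread[of w "Some m"]
    by (cases "Some m \<in> reps") simp_all
  then show "z = w"
    by (simp add: vec_eq_iff)
qed

lemma tied_space_eq_spread_image:
  "tied_space = spread ` {z. \<forall>m. Some m \<notin> reps \<longrightarrow> z $ m = 0}"
proof (intro subset_antisym subsetI)
  fix z assume z: "z \<in> tied_space"
  define w :: "real ^ 'n" where "w = (\<chi> m. if Some m \<in> reps then z $ m else 0)"
  have "ext_coord w (rep i) = ext_coord z (rep i)" for i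
    using rep_in_reps[of i] by (cases "rep i") (simp_all add: w_def)
  with z have "ext_coord z i = ext_coord (spread w) i" for i
    by (simp add: tied_space_def ext_coord_spread)
  from this[of "Some _"] have "z = spread w"
    by (simp add: vec_eq_iff)
  then show "z \<in> spread ` {z. \<forall>m. Some m \<notin> reps \<longrightarrow> z $ m = 0}"
    by (simp add: w_def)
qed (auto simp: tied_space_def ext_coord_spread)

lemma dim_tied_space: "dim tied_space = card reps - 1"
proof -
  define S :: "(real ^ 'n) set" where "S = {z. \<forall>m. Some m \<notin> reps \<longrightarrow> z $ m = 0}"
  have "subspace S"
    by (simp add: subspace_def S_def)
  then have "dim (spread ` S) = dim S"
    using linear_spread inj_on_spread unfolding S_def
    by (intro dim_image_eq) (simp_all add: span_eq_iff[THEN iffD2])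
  also have "dim S = card {m. Some m \<in> reps}"
    unfolding S_def using dim_substandard_cart[of "{m. Some m \<in> reps}", where 'a = real]
    by (simp add: dim_vec_eq)
  also have "\<dots> = card (reps - {None})"
  proof -
    have "i \<in> reps - {None} \<longleftrightarrow> i \<in> Some ` {m. Some m \<in> reps}" for i
      by (cases i) auto
    then have "reps - {None} = Some ` {m. Some m \<in> reps}"
      by blast
    then show ?thesis
      by (simp add: card_image)
  qed
  finally show ?thesis
    by (simp add: tied_space_eq_spread_image S_def)
qed

lemma aff_dim_flat: "aff_dim flat = int (card reps) - 1"
proof -
  obtain p where p: "p \<in> flat"
    using nonempty P_subset_flat by blast
  have "aff_dim flat = int (card reps - 1)"
    unfolding aff_dim_dim_affine_diffs[OF affine_flat p] flat_translation[OF p] dim_tied_space ..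
  with card_reps_pos show ?thesis
    by linarith
qed

lemma aff_dim_closed_alcove:
  assumes x: "x \<in> generic"
  shows "aff_dim (closed_alcove x) = aff_dim flat"
proof (rule antisym)
  show "aff_dim (closed_alcove x) \<le> aff_dim flat"
    by (rule aff_dim_subset[OF closed_alcove_subset_flat])
  have "aff_dim (alcove x) = aff_dim flat"
    using mem_alcove_self[OF x] by (intro aff_dim_openin openin_alcove affine_flat) auto
  then show "aff_dim flat \<le> aff_dim (closed_alcove x)"
    using aff_dim_subset[OF alcove_subset_closed_alcove] by metis
qed

lemma aff_dim_P:
  assumes "x \<in> generic"
  shows "aff_dim P = aff_dim flat"
  using aff_dim_subset[OF closed_alcove_subset[OF assms]] aff_dim_subset[OF P_subset_flat]
    aff_dim_closed_alcove[OF assms] by linarith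

end

section \<open>Separating hyperplanes and adjacency\<close>

lemma graph_dist_eqI:
  fixes f :: "'v \<Rightarrow> nat"
  assumes start: "f u = 0"
    and edge: "\<And>v w. (v, w) \<in> E \<Longrightarrow> f w \<le> Suc (f v)"
    and descent: "\<And>w. w \<in> V \<Longrightarrow> w \<noteq> u \<Longrightarrow> \<exists>v\<in>V. (v, w) \<in> E \<and> f w = Suc (f v)"
    and "w \<in> V"
  shows "graph_dist E u w = f w"
  unfolding graph_dist_def
proof (rule Least_equality)
  show "(u, w) \<in> E ^^ f w"
    using \<open>w \<in> V\<close>
  proof (induction "f w" arbitrary: w)
    case 0
    then show ?case
      using descent[of w] by auto
  next
    case (Suc n)
    then have "w \<noteq> u"
      using start by auto
    then obtain v where "v \<in> V" "(v, w) \<in> E" "f w = Suc (f v)"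
      using descent Suc.prems by blast
    with Suc.hyps show ?case by auto
  qed
  show "f w \<le> k" if "(u, w) \<in> E ^^ k" for k
    using that
  proof (induction k arbitrary: w)
    case 0
    with start show ?case by simp
  next
    case (Suc k)
    then obtain v where "(u, v) \<in> E ^^ k" "(v, w) \<in> E" by auto
    with Suc.IH[of v] edge[of v w] show ?case by simp
  qed
qed

context alcoved_polytope
begin

text \<open>Hyperplanes are oriented, with \<open>x\<close> on the negative side, so that each one is counted only
  once: as \<open>(i, j, l)\<close> or as \<open>(j, i, - l)\<close>.\<close>

definition separating :: "real ^ 'n \<Rightarrow> real ^ 'n \<Rightarrow> ('n option \<times> 'n option \<times> int) set" where
  "separating x y = {(i, j, l). i \<in> reps \<and> j \<in> reps \<and>
    coord_diff x i j < of_int l \<and> of_int l < coord_diff y i j}"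

lemma mem_separating_iff:
  "(i, j, l) \<in> separating x y \<longleftrightarrow>
    i \<in> reps \<and> j \<in> reps \<and> coord_diff x i j < of_int l \<and> of_int l < coord_diff y i j"
  by (simp add: separating_def)

lemma mem_separatingD:
  assumes "(i, j, l) \<in> separating x y"
  shows "i \<in> reps" "j \<in> reps" "i \<noteq> j" "coord_diff x i j < of_int l" "of_int l < coord_diff y i j"
  using assms by (auto simp: mem_separating_iff)

lemma separating_swap: "separating y x = (\<lambda>(i, j, l). (j, i, - l)) ` separating x y"
proof (rule set_eqI)
  fix h :: "'n option \<times> 'n option \<times> int"
  obtain i j l where h: "h = (i, j, l)"
    by (cases h)
  have "h \<in> separating y x \<longleftrightarrow> (j, i, - l) \<in> separating x y"
    by (auto simp: h mem_separating_iff coord_diff_swap[of _ j i])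
  also have "\<dots> \<longleftrightarrow> h \<in> (\<lambda>(i, j, l). (j, i, - l)) ` separating x y"
    by (auto simp: h image_iff intro!: bexI[of _ "(j, i, - l)"])
  finally show "h \<in> separating y x \<longleftrightarrow> h \<in> (\<lambda>(i, j, l). (j, i, - l)) ` separating x y" .
qed

lemma finite_separating: "finite (separating x y)"
proof (rule finite_subset)
  show "separating x y \<subseteq> (SIGMA i:UNIV. SIGMA j:UNIV. {level x i j ..\<lceil>coord_diff y i j\<rceil>})"
    by (auto simp: mem_separating_iff floor_le_iff le_ceiling_iff)
  show "finite (SIGMA i:UNIV. SIGMA j:UNIV. {level x i j ..\<lceil>coord_diff y i j\<rceil>})"
    by (intro finite_SigmaI) auto
qed

lemma mem_separating_iff_level:
  assumes "y \<in> generic"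
  shows "(i, j, l) \<in> separating x y \<longleftrightarrow>
    i \<in> reps \<and> j \<in> reps \<and> level x i j < l \<and> l \<le> level y i j"
proof (cases "i = j")
  case False
  have "of_int l < coord_diff y i j \<longleftrightarrow> l \<le> level y i j" if "i \<in> reps" "j \<in> reps"
    using level_less[OF assms that False] by linarith
  then show ?thesis
    by (auto simp: mem_separating_iff floor_less_iff)
qed (auto simp: mem_separating_iff)

lemma level_eq_if_not_separating:
  assumes x: "x \<in> generic" and y: "y \<in> generic" and ij: "i \<in> reps" "j \<in> reps"
    and "\<And>l. (i, j, l) \<notin> separating x y" "\<And>l. (j, i, l) \<notin> separating x y"
  shows "level x i j = level y i j"
proof (cases "i = j")
  case False
  have "level y i j \<le> level x i j" "level y j i \<le> level x j i"
    using assms by (auto simp: mem_separating_iff_level[OF y] not_less[symmetric])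
  then show ?thesis
    using level_swap[OF x ij False] level_swap[OF y ij False] by linarith
qed simp

lemma separating_empty_iff:
  assumes x: "x \<in> generic" and y: "y \<in> generic"
  shows "separating x y = {} \<longleftrightarrow> closed_alcove x = closed_alcove y"
proof
  assume "separating x y = {}"
  then show "closed_alcove x = closed_alcove y"
    by (intro closed_alcove_cong level_eq_if_not_separating[OF x y]) auto
next
  assume "closed_alcove x = closed_alcove y"
  then show "separating x y = {}"
    using closed_alcove_eqD[OF x y] by (force simp: mem_separating_iff_level[OF y])
qed

lemma separating_cong:
  assumes "x \<in> generic" "x' \<in> generic" "closed_alcove x = closed_alcove x'"
  shows "separating q x = separating q x'"
  using closed_alcove_eqD[OF assms] assms(1,2) by (auto simp: mem_separating_iff_level)

lemma separating_triangle:
  assumes x: "x \<in> generic"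
  shows "separating q y \<subseteq> separating q x \<union> separating x y"
proof safe
  fix i j l assume mem: "(i, j, l) \<in> separating q y" and "(i, j, l) \<notin> separating x y"
  then have "i \<noteq> j" "of_int l \<le> coord_diff x i j"
    by (auto simp: mem_separating_iff)
  moreover have "coord_diff x i j \<noteq> of_int l"
    using mem \<open>i \<noteq> j\<close> x by (metis Ints_of_int generic_iff mem_separating_iff)
  ultimately show "(i, j, l) \<in> separating q x"
    using mem by (simp add: mem_separating_iff)
qed

lemma separating_singleton_swap: "separating x y = {(i, j, l)} \<Longrightarrow> separating y x = {(j, i, - l)}"
  by (simp add: separating_swap[of y x])

lemma separating_adjacent_insert:
  assumes z: "z \<in> generic" and x: "x \<in> generic"
    and sep: "separating z x = {h}" and h: "h \<in> separating q x"
  shows "separating q x = insert h (separating q z)" "h \<notin> separating q z"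
proof -
  obtain i j l where ijl: "h = (i, j, l)"
    by (cases h)
  have "coord_diff q i j < l" "coord_diff z i j < l"
    using h sep mem_separatingD(4)[of i j l q x] mem_separatingD(4)[of i j l z x]
    by (simp_all add: ijl)
  then show "h \<notin> separating q z"
    by (simp add: ijl mem_separating_iff)
  have "separating q z \<subseteq> separating q x \<union> {(j, i, - l)}"
    using separating_triangle[OF x, of q z] separating_singleton_swap sep ijl by metis
  moreover have "(j, i, - l) \<notin> separating q z"
    using \<open>coord_diff q i j < l\<close> by (simp add: mem_separating_iff coord_diff_swap[of q j i])
  ultimately show "separating q x = insert h (separating q z)"
    using separating_triangle[OF z, of q x] sep h by auto
qed

lemma card_separating_adjacent:
  assumes z: "z \<in> generic" and x: "x \<in> generic" and sep: "separating z x = {h}"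
  shows "card (separating q x) \<le> Suc (card (separating q z))"
    and "card (separating q x) = Suc (card (separating q z)) \<longleftrightarrow> h \<in> separating q x"
proof -
  have subset: "separating q x \<subseteq> insert h (separating q z)"
    using separating_triangle[OF z, of q x] sep by auto
  have "card (separating q x) = Suc (card (separating q z))" if "h \<in> separating q x"
    using separating_adjacent_insert[OF z x sep that] finite_separating by simp
  moreover have "card (separating q x) \<le> card (separating q z)" if "h \<notin> separating q x"
    using subset that by (intro card_mono finite_separating) auto
  ultimately show "card (separating q x) \<le> Suc (card (separating q z))"
    "card (separating q x) = Suc (card (separating q z)) \<longleftrightarrow> h \<in> separating q x"
    by fastforce+
qed

lemma separating_singleton_inject:
  assumes x: "x \<in> generic" and z: "z \<in> generic" and z': "z' \<in> generic"
    and eq: "separating z x = {h}" "separating z' x = {h}"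
  shows "closed_alcove z = closed_alcove z'"
proof -
  obtain i j l where ijl: "h = (i, j, l)"
    by (cases h)
  have "coord_diff z i j < l" "coord_diff z' i j < l"
    using eq ijl by (metis insertI1 mem_separating_iff)+
  then have "(i, j, l) \<notin> separating z z'" "(j, i, - l) \<notin> separating z z'"
    by (auto simp: mem_separating_iff coord_diff_swap[of _ j i])
  moreover have "separating z z' \<subseteq> {(i, j, l), (j, i, - l)}"
    using separating_triangle[OF x, of z z'] eq(1) separating_singleton_swap[OF eq(2)[unfolded ijl]]
    by (auto simp: ijl)
  ultimately have "separating z z' = {}"
    by blast
  with separating_empty_iff[OF z z'] show ?thesis by blast
qed

lemma
  assumes x: "x \<in> generic" and y: "y \<in> generic" and sep: "separating x y = {(i, j, l)}"
  shows separating_singleton_lower_level: "level x i j = l - 1"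
    and separating_singleton_upper_level: "level y i j = l"
    and separating_singleton_other_level: "\<And>i' j'. i' \<in> reps \<Longrightarrow> j' \<in> reps \<Longrightarrow>
      {i', j'} \<noteq> {i, j} \<Longrightarrow> level x i' j' = level y i' j'"
proof -
  have "(i, j, l) \<in> separating x y"
    and "(i, j, l - 1) \<notin> separating x y" "(i, j, l + 1) \<notin> separating x y"
    unfolding sep by simp_all
  then show "level x i j = l - 1" "level y i j = l"
    unfolding mem_separating_iff_level[OF y] by linarith+
  fix i' j' assume "i' \<in> reps" "j' \<in> reps" "{i', j'} \<noteq> {i, j}"
  then show "level x i' j' = level y i' j'"
    by (intro level_eq_if_not_separating[OF x y]) (auto simp: sep)
qed

lemma separating_hyperplane_contains_Int:
  assumes y: "y \<in> generic" and sep: "(i, j, l) \<in> separating x y"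
    and z: "z \<in> closed_alcove x \<inter> closed_alcove y"
  shows "coord_diff z i j = of_int l"
proof -
  have ij: "i \<in> reps" "j \<in> reps" and "level x i j + 1 \<le> l" "l \<le> level y i j"
    using sep by (auto simp: mem_separating_iff_level[OF y])
  then have "real_of_int (level x i j) + 1 \<le> l" "real_of_int l \<le> level y i j"
    by linarith+
  with closed_alcove_upper[of z x i j] closed_alcove_lower[of z y i j] z ij show ?thesis
    by simp
qed

lemma aff_dim_flat_Int_hyperplane:
  assumes ij: "i \<in> reps" "j \<in> reps" "i \<noteq> j"
  shows "aff_dim (flat \<inter> alcove_hyperplane i j l) = aff_dim flat - 1"
proof -
  have "\<exists>y\<in>flat. coord_diff y i j = r" for r
    using ex_flat_point[of "\<lambda>k. if k = i then r else 0"] ij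
    by (smt (verit) coord_diff_def)
  then obtain y z where "y \<in> flat" "coord_diff y i j = l" "z \<in> flat" "coord_diff z i j = l + 1"
    by blast
  then show ?thesis
    unfolding alcove_hyperplane_inner aff_dim_affine_Int_hyperplane[OF affine_flat] coord_diff_inner
    by auto
qed

lemma flat_hyperplane_subset_imp_eq:
  assumes ij: "i \<in> reps" "j \<in> reps" "i \<noteq> j" and kl: "k \<in> reps" "k' \<in> reps" "k \<noteq> k'"
    and subset: "flat \<inter> alcove_hyperplane i j l \<subseteq> alcove_hyperplane k k' l'"
  shows "{k, k'} = {i, j}"
proof (rule ccontr)
  assume "{k, k'} \<noteq> {i, j}"
  then obtain m where m: "m \<in> {k, k'}" "m \<notin> {i, j}"
    using kl(3) ij(3) by blast
  define g :: "real \<Rightarrow> 'n option \<Rightarrow> real" where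
    "g r k = (if k = m then r else if k = i then l else 0)" for r k
  have "g r k - g r k' = l'" for r
  proof -
    obtain y where y: "y \<in> flat" "\<And>k. k \<in> reps \<Longrightarrow> ext_coord y k = g r k - g r None"
      using ex_flat_point[of "g r"] by blast
    then have diff: "coord_diff y k k' = g r k - g r k'" if "k \<in> reps" "k' \<in> reps" for k k'
      using that by (simp add: coord_diff_def)
    have "coord_diff y i j = l"
      using m(2) ij by (auto simp: diff g_def)
    then have "coord_diff y k k' = l'"
      using subset y(1) by (auto simp: mem_alcove_hyperplane)
    with diff[OF kl(1,2)] show ?thesis
      by simp
  qed
  from this[of 0] this[of 1] m(1) kl(3) show False
    by (auto simp: g_def split: if_splits)
qed

lemma affine_hull_closed_alcove_Int:
  assumes y: "y \<in> generic" and sep: "(i, j, l) \<in> separating x y"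
    and nonempty: "closed_alcove x \<inter> closed_alcove y \<noteq> {}"
    and dim: "aff_dim (closed_alcove x \<inter> closed_alcove y) = aff_dim flat - 1"
  shows "affine hull (closed_alcove x \<inter> closed_alcove y) = flat \<inter> alcove_hyperplane i j l"
proof -
  have "affine (flat \<inter> alcove_hyperplane i j l)"
    unfolding alcove_hyperplane_inner by (intro affine_Int affine_flat affine_hyperplane)
  moreover have "closed_alcove x \<inter> closed_alcove y \<subseteq> flat \<inter> alcove_hyperplane i j l"
    using separating_hyperplane_contains_Int[OF y sep] closed_alcove_subset_flat
    by (auto simp: mem_alcove_hyperplane)
  moreover have "aff_dim (flat \<inter> alcove_hyperplane i j l) = aff_dim flat - 1"
    by (rule aff_dim_flat_Int_hyperplane[OF mem_separatingD(1-3)[OF sep]])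
  ultimately show ?thesis
    using nonempty dim by (intro affine_dim_equal affine_affine_hull hull_minimal) auto
qed

lemma facet_imp_separating_singleton:
  assumes x: "x \<in> generic" and y: "y \<in> generic"
    and facet: "(closed_alcove x \<inter> closed_alcove y) facet_of closed_alcove x"
  shows "\<exists>h. separating x y = {h}"
proof -
  have nonempty: "closed_alcove x \<inter> closed_alcove y \<noteq> {}"
    and dim: "aff_dim (closed_alcove x \<inter> closed_alcove y) = aff_dim flat - 1"
    using facet aff_dim_closed_alcove[OF x] by (auto simp: facet_of_def)
  have unique: "h' = h" if h: "h \<in> separating x y" and h': "h' \<in> separating x y" for h h'
  proof -
    obtain i j l k k' l' where eq: "h = (i, j, l)" "h' = (k, k', l')"
      by (cases h, cases h')
    note sep = h[unfolded eq] h'[unfolded eq]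
    obtain z where "z \<in> closed_alcove x \<inter> closed_alcove y"
      using nonempty by blast
    then have z: "coord_diff z i j = l" "coord_diff z k k' = l'"
      using separating_hyperplane_contains_Int[OF y] sep by blast+
    have "flat \<inter> alcove_hyperplane i j l = flat \<inter> alcove_hyperplane k k' l'"
      using affine_hull_closed_alcove_Int[OF y _ nonempty dim] sep by blast
    then have "{k, k'} = {i, j}"
      by (intro flat_hyperplane_subset_imp_eq[OF mem_separatingD(1-3)[OF sep(1)]
            mem_separatingD(1-3)[OF sep(2)]]) auto
    moreover have "\<not> (k = j \<and> k' = i)"
      using mem_separatingD(4)[OF sep(1)] mem_separatingD(4)[OF sep(2)] z
      by (auto simp: coord_diff_swap[of _ j i])
    ultimately have "k = i" "k' = j"
      by (auto simp: doubleton_eq_iff)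
    with z show "h' = h"
      by (simp add: eq)
  qed
  have "closed_alcove x \<noteq> closed_alcove y"
    using facet by auto
  then have "separating x y \<noteq> {}"
    by (simp add: separating_empty_iff[OF x y])
  with unique show ?thesis by blast
qed

definition wall_nbhd :: "real ^ 'n \<Rightarrow> 'n option \<Rightarrow> 'n option \<Rightarrow> (real ^ 'n) set" where
  "wall_nbhd x i j = {z. \<forall>i'\<in>reps. \<forall>j'\<in>reps. i' \<noteq> j' \<and> {i', j'} \<noteq> {i, j} \<longrightarrow>
    level x i' j' < coord_diff z i' j' \<and> coord_diff z i' j' < level x i' j' + 1}"

lemma open_wall_nbhd: "open (wall_nbhd x i j)"
proof -
  have "wall_nbhd x i j = (\<Inter>i'\<in>reps. \<Inter>j'\<in>{j' \<in> reps. i' \<noteq> j' \<and> {i', j'} \<noteq> {i, j}}.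
      {z. (ext_axis i' - ext_axis j') \<bullet> z > level x i' j'} \<inter>
      {z. (ext_axis i' - ext_axis j') \<bullet> z < level x i' j' + 1})"
    by (auto simp: wall_nbhd_def coord_diff_inner)
  then show ?thesis
    by (auto intro!: open_INT open_Int open_halfspace_lt open_halfspace_gt)
qed

lemma mem_closed_alcove_IntI:
  assumes x: "x \<in> generic" and y: "y \<in> generic" and sep: "separating x y = {(i, j, l)}"
    and z: "z \<in> flat" "coord_diff z i j = l" and nbhd: "z \<in> closed_alcove x \<or> z \<in> wall_nbhd x i j"
  shows "z \<in> closed_alcove x \<inter> closed_alcove y"
proof -
  have mem: "(i, j, l) \<in> separating x y"
    by (simp add: sep)
  note ij = mem_separatingD(1-3)[OF mem]
  note levels = separating_singleton_lower_level[OF x y sep]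
    separating_singleton_upper_level[OF x y sep] level_swap[OF x ij] level_swap[OF y ij]
  have "level w i' j' \<le> coord_diff z i' j' \<and> coord_diff z i' j' \<le> of_int (level w i' j') + 1"
    if "i' \<in> reps" "j' \<in> reps" "i' \<noteq> j'" "w \<in> {x, y}" for w i' j'
  proof (cases "{i', j'} = {i, j}")
    case True
    then consider "i' = i" "j' = j" | "i' = j" "j' = i"
      by (auto simp: doubleton_eq_iff)
    then show ?thesis
      using levels z(2) that(4) by cases (auto simp: coord_diff_swap[of z j i])
  next
    case False
    then have "level w i' j' = level x i' j'"
      using separating_singleton_other_level[OF x y sep that(1,2)] that(4) by auto
    moreover have "level x i' j' \<le> coord_diff z i' j' \<and>
        coord_diff z i' j' \<le> of_int (level x i' j') + 1"
      using nbhd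
    proof
      assume "z \<in> closed_alcove x"
      with that(1,2) show ?thesis
        by (simp add: closed_alcove_def)
    next
      assume "z \<in> wall_nbhd x i j"
      with that(1-3) False have "level x i' j' < coord_diff z i' j' \<and>
          coord_diff z i' j' < of_int (level x i' j') + 1"
        by (simp add: wall_nbhd_def)
      then show ?thesis by linarith
    qed
    ultimately show ?thesis by simp
  qed
  then show ?thesis
    using z(1) by (auto intro!: closed_alcoveI)
qed

lemma closed_alcove_Int_eq_hyperplane:
  assumes x: "x \<in> generic" and y: "y \<in> generic" and sep: "separating x y = {(i, j, l)}"
  shows "closed_alcove x \<inter> closed_alcove y = closed_alcove x \<inter> alcove_hyperplane i j l"
proof
  show "closed_alcove x \<inter> alcove_hyperplane i j l \<subseteq> closed_alcove x \<inter> closed_alcove y"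
  proof
    fix z assume "z \<in> closed_alcove x \<inter> alcove_hyperplane i j l"
    then show "z \<in> closed_alcove x \<inter> closed_alcove y"
      using closed_alcove_subset_flat
      by (intro mem_closed_alcove_IntI[OF assms]) (auto simp: mem_alcove_hyperplane)
  qed
  show "closed_alcove x \<inter> closed_alcove y \<subseteq> closed_alcove x \<inter> alcove_hyperplane i j l"
    using separating_hyperplane_contains_Int[OF y, of i j l x] sep
    by (auto simp: mem_alcove_hyperplane)
qed

lemma ex_wall_point:
  assumes x: "x \<in> generic" and y: "y \<in> generic" and sep: "separating x y = {(i, j, l)}"
  shows "flat \<inter> alcove_hyperplane i j l \<inter> wall_nbhd x i j \<noteq> {}"
proof -
  have mem: "(i, j, l) \<in> separating x y"
    by (simp add: sep)
  define e where "e = (l - coord_diff x i j) / (coord_diff y i j - coord_diff x i j)"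
  have e: "0 < e" "e \<le> 1" "e * (coord_diff y i j - coord_diff x i j) = l - coord_diff x i j"
    using mem_separatingD(4,5)[OF mem] by (auto simp: e_def field_simps)
  define f where "f = x + e *\<^sub>R (y - x)"
  have "level x i' j' < coord_diff f i' j' \<and> coord_diff f i' j' < of_int (level x i' j') + 1"
    if ij': "i' \<in> reps" "j' \<in> reps" "i' \<noteq> j'" "{i', j'} \<noteq> {i, j}" for i' j'
  proof -
    have "level y i' j' = level x i' j'"
      using separating_singleton_other_level[OF x y sep ij'(1,2,4)] by simp
    then have "level x i' j' < coord_diff y i' j'" "coord_diff y i' j' < of_int (level x i' j') + 1"
      using level_less[OF y ij'(1-3)] floor_correct[of "coord_diff y i' j'"] by simp_all
    then show ?thesis
      using e(1,2) floor_correct[of "coord_diff x i' j'"]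
      by (simp add: f_def coord_diff_toward less_toward toward_less)
  qed
  then have "f \<in> wall_nbhd x i j"
    by (simp add: wall_nbhd_def)
  moreover have "f \<in> flat"
    unfolding f_def by (intro toward_in_flat generic_in_flat x y)
  moreover have "coord_diff f i j = l"
    using e(3) by (simp add: f_def coord_diff_toward)
  ultimately show ?thesis
    by (auto simp: mem_alcove_hyperplane)
qed

lemma
  assumes x: "x \<in> generic" and y: "y \<in> generic" and sep: "separating x y = {(i, j, l)}"
  shows separating_singleton_imp_Int_nonempty: "closed_alcove x \<inter> closed_alcove y \<noteq> {}"
    and aff_dim_closed_alcove_Int: "aff_dim (closed_alcove x \<inter> closed_alcove y) = aff_dim flat - 1"
proof -
  define H where "H = flat \<inter> alcove_hyperplane i j l"
  have mem: "(i, j, l) \<in> separating x y"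
    by (simp add: sep)
  have "affine H"
    unfolding H_def alcove_hyperplane_inner by (intro affine_Int affine_flat affine_hyperplane)
  have nonempty: "H \<inter> wall_nbhd x i j \<noteq> {}"
    unfolding H_def by (rule ex_wall_point[OF assms])
  have lower: "H \<inter> wall_nbhd x i j \<subseteq> closed_alcove x \<inter> closed_alcove y"
  proof
    fix z assume "z \<in> H \<inter> wall_nbhd x i j"
    then show "z \<in> closed_alcove x \<inter> closed_alcove y"
      by (intro mem_closed_alcove_IntI[OF assms]) (auto simp: H_def mem_alcove_hyperplane)
  qed
  have upper: "closed_alcove x \<inter> closed_alcove y \<subseteq> H"
    using closed_alcove_Int_eq_hyperplane[OF assms] closed_alcove_subset_flat by (auto simp: H_def)
  have "aff_dim (H \<inter> wall_nbhd x i j) = aff_dim H"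
    using nonempty \<open>affine H\<close> by (intro aff_dim_openin openin_open_Int open_wall_nbhd)
  moreover have "aff_dim H = aff_dim flat - 1"
    unfolding H_def by (rule aff_dim_flat_Int_hyperplane[OF mem_separatingD(1-3)[OF mem]])
  ultimately show "aff_dim (closed_alcove x \<inter> closed_alcove y) = aff_dim flat - 1"
    using aff_dim_subset[OF lower] aff_dim_subset[OF upper] by simp
  show "closed_alcove x \<inter> closed_alcove y \<noteq> {}"
    using lower nonempty by blast
qed

lemma facet_if_separating_singleton:
  assumes x: "x \<in> generic" and y: "y \<in> generic" and sep: "separating x y = {(i, j, l)}"
  shows "(closed_alcove x \<inter> closed_alcove y) facet_of closed_alcove x"
proof -
  have mem: "(i, j, l) \<in> separating x y"
    by (simp add: sep)
  have "(ext_axis i - ext_axis j) \<bullet> z \<le> l" if "z \<in> closed_alcove x" for z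
    using closed_alcove_upper[OF that mem_separatingD(1,2)[OF mem]]
      separating_singleton_lower_level[OF x y sep]
    by (simp add: coord_diff_inner)
  then have "(closed_alcove x \<inter> closed_alcove y) face_of closed_alcove x"
    unfolding closed_alcove_Int_eq_hyperplane[OF x y sep] alcove_hyperplane_inner
    by (intro face_of_Int_supporting_hyperplane_le convex_closed_alcove)
  then show ?thesis
    using separating_singleton_imp_Int_nonempty[OF assms] aff_dim_closed_alcove_Int[OF assms]
      aff_dim_closed_alcove[OF x]
    by (simp add: facet_of_def)
qed

abbreviation adjacency :: "((real ^ 'n) set \<times> (real ^ 'n) set) set" where
  "adjacency \<equiv> dual_graph (closed_alcove ` generic)"

lemma adjacency_iff_separating_singleton:
  assumes x: "x \<in> generic" and y: "y \<in> generic"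
  shows "(closed_alcove x, closed_alcove y) \<in> adjacency \<longleftrightarrow> (\<exists>h. separating x y = {h})"
proof
  assume "(closed_alcove x, closed_alcove y) \<in> adjacency"
  then show "\<exists>h. separating x y = {h}"
    by (intro facet_imp_separating_singleton[OF x y]) (simp add: dual_graph_def)
next
  assume "\<exists>h. separating x y = {h}"
  then obtain i j l where sep: "separating x y = {(i, j, l)}"
    by auto
  have "(closed_alcove x \<inter> closed_alcove y) facet_of closed_alcove x"
    "(closed_alcove y \<inter> closed_alcove x) facet_of closed_alcove y"
    using facet_if_separating_singleton[OF x y sep]
      facet_if_separating_singleton[OF y x separating_singleton_swap[OF sep]] by blast+
  then show "(closed_alcove x, closed_alcove y) \<in> adjacency"
    using x y by (simp add: dual_graph_def Int_commute)
qed

end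

section \<open>Barycentric coordinates\<close>

definition cyclic_ivl :: "nat \<Rightarrow> nat \<Rightarrow> nat \<Rightarrow> nat set" where
  "cyclic_ivl N b a = (if b < a then {b..<a} else {..<N} - {a..<b})"

lemma mem_cyclic_ivl_start: "b < N \<Longrightarrow> b \<in> cyclic_ivl N b a"
  by (simp add: cyclic_ivl_def)

lemma cyclic_ivl_subset: "a < N \<Longrightarrow> cyclic_ivl N b a \<subseteq> {..<N}"
  by (auto simp: cyclic_ivl_def)

lemma cyclic_ivl_Suc_mod: "1 < N \<Longrightarrow> m < N \<Longrightarrow> cyclic_ivl N m (Suc m mod N) = {m}"
  by (cases "Suc m = N") (auto simp: cyclic_ivl_def)

lemma cyclic_ivl_singletonD:
  assumes ab: "a < N" "b < N" "a \<noteq> b" and eq: "cyclic_ivl N b a = {m}"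
  shows "b = m" "a = Suc m mod N"
proof -
  show b: "b = m"
    using mem_cyclic_ivl_start[OF ab(2), of a] eq by simp
  show "a = Suc m mod N"
  proof (cases "b < a")
    case True
    then have "a - 1 \<in> cyclic_ivl N b a"
      by (auto simp: cyclic_ivl_def)
    with eq b True ab(1) show ?thesis by auto
  next
    case False
    have "N - 1 \<in> cyclic_ivl N b a" "a = 0 \<or> 0 \<in> cyclic_ivl N b a"
      using False ab by (auto simp: cyclic_ivl_def)
    with eq ab False have "N = Suc m" "a = 0"
      by auto
    then show ?thesis by simp
  qed
qed

lemma sum_pos_if_one_negative:
  fixes w :: "'a \<Rightarrow> real"
  assumes "finite M" "M \<noteq> {}" "M \<noteq> {m}"
    and pos: "\<And>k. k \<in> M \<Longrightarrow> k \<noteq> m \<Longrightarrow> 0 < w k" and pair: "\<And>k. k \<in> M \<Longrightarrow> k \<noteq> m \<Longrightarrow> 0 < w m + w k"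
  shows "0 < sum w M"
proof (cases "m \<in> M")
  case True
  obtain k where k: "k \<in> M" "k \<noteq> m"
    using assms(2,3) by blast
  have "sum w M = sum w (M - {m, k}) + sum w {m, k}"
    using k True \<open>finite M\<close> by (intro sum.subset_diff) auto
  moreover have "0 \<le> sum w (M - {m, k})"
    using pos by (intro sum_nonneg) (auto simp: less_imp_le)
  ultimately show ?thesis
    using pair[OF k] k(2) by simp
next
  case False
  then show ?thesis
    using assms(1,2) pos by (intro sum_pos) blast+
qed

text \<open>Barycentric coordinates of a point just beyond the \<open>m\<close>-th facet of an alcove; the sums over
  \<open>M\<close> are its signed distances from the hyperplanes that bound the alcove in some direction.\<close>

lemma ex_weights_beyond_facet:
  assumes N: "1 < N" and m: "m < N"
  obtains w :: "nat \<Rightarrow> real" where "(\<Sum>k<N. w k) = 1" "- 1 < w m" "w m < 0"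
    "\<forall>M. M \<noteq> {} \<and> M \<subseteq> {..<N} \<and> M \<noteq> {m} \<longrightarrow> 0 < sum w M"
proof -
  define c where "c = (real N + 1) / (real N * (real N - 1))"
  define w where "w = (\<lambda>k. if k = m then - 1 / real N else c)"
  have "0 < real N" "0 < real N - 1"
    using N by simp_all
  then have c: "(real N - 1) * c = 1 + 1 / real N" "0 < c"
      "c = 1 / real N + 2 / (real N * (real N - 1))"
    by (simp_all add: c_def divide_simps)
  have pos: "0 < w k" "0 < w m + w k" if "k \<noteq> m" for k
    using that N c(2,3) by (simp_all add: w_def)
  show ?thesis
  proof (rule that)
    have "(\<Sum>k<N. w k) = w m + (\<Sum>k\<in>{..<N} - {m}. c)"
      using m by (simp add: sum.remove[of _ m] w_def)
    also have "\<dots> = - 1 / real N + (real N - 1) * c"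
      using N m by (simp add: w_def of_nat_diff)
    also have "\<dots> = 1"
      by (simp add: c(1))
    finally show "(\<Sum>k<N. w k) = 1" .
    show "- 1 < w m" "w m < 0"
      using N by (simp_all add: w_def)
    show "\<forall>M. M \<noteq> {} \<and> M \<subseteq> {..<N} \<and> M \<noteq> {m} \<longrightarrow> 0 < sum w M"
      using pos by (auto intro!: sum_pos_if_one_negative[of _ m] intro: finite_subset)
  qed
qed

lemma
  fixes f :: "'a \<Rightarrow> 'b::linorder"
  assumes "finite S" and inj: "inj_on f S"
  defines "e \<equiv> \<lambda>a. the_inv_into S f (sorted_list_of_set (f ` S) ! a)"
  shows bij_betw_the_inv_into_sorted_nth: "bij_betw e {..<card S} S"
    and the_inv_into_sorted_nth_less: "a < b \<Longrightarrow> b < card S \<Longrightarrow> f (e a) < f (e b)"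
proof -
  let ?xs = "sorted_list_of_set (f ` S)"
  have len: "length ?xs = card S"
    using inj by (simp add: card_image)
  have nth: "bij_betw (nth ?xs) {..<card S} (f ` S)"
    using len \<open>finite S\<close> by (intro bij_betw_nth) auto
  then show "bij_betw e {..<card S} S"
    using bij_betw_trans[OF nth bij_betw_the_inv_into[OF inj_on_imp_bij_betw[OF inj]]]
    by (simp add: e_def comp_def)
  have "f (e a) = ?xs ! a" if "a < card S" for a
    using bij_betwE[OF nth] that inj unfolding e_def by (intro f_the_inv_into_f) auto
  then show "f (e a) < f (e b)" if "a < b" "b < card S"
    using that len sorted_wrt_nth_less[OF strict_sorted_list_of_set that(1), of "f ` S"] by simp
qed

lemma floor_diff_frac:
  fixes u v :: real
  shows "\<lfloor>u - v\<rfloor> = \<lfloor>u\<rfloor> - \<lfloor>v\<rfloor> - of_bool (frac u < frac v)"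
proof (rule floor_unique)
  have "0 \<le> u - \<lfloor>u\<rfloor>" "0 \<le> v - \<lfloor>v\<rfloor>" "u - \<lfloor>u\<rfloor> < 1" "v - \<lfloor>v\<rfloor> < 1"
    by linarith+
  then show "of_int (\<lfloor>u\<rfloor> - \<lfloor>v\<rfloor> - of_bool (frac u < frac v)) \<le> u - v"
    "u - v < of_int (\<lfloor>u\<rfloor> - \<lfloor>v\<rfloor> - of_bool (frac u < frac v)) + 1"
    by (cases "frac u < frac v";
        simp only: frac_def of_bool_eq of_int_diff of_int_0 of_int_1; linarith)+
qed

context alcoved_polytope
begin

text \<open>Modulo 1, the coordinates of a generic point indexed by \<^const>\<open>reps\<close> are distinct points on a
  circle, which \<open>enum x\<close> lists in cyclic order starting at 0.  The barycentric coordinates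
  \<open>bary x y\<close> with respect to the vertices of the simplex around \<open>x\<close> are the lengths of the arcs
  between consecutive points, and \<open>wall x m\<close> is the hyperplane where the \<open>m\<close>-th arc vanishes.\<close>

definition enum :: "real ^ 'n \<Rightarrow> nat \<Rightarrow> 'n option" where
  "enum x m = (let f = \<lambda>i. frac (ext_coord x i) in
    the_inv_into reps f (sorted_list_of_set (f ` reps) ! m))"

definition offset :: "real ^ 'n \<Rightarrow> real ^ 'n \<Rightarrow> nat \<Rightarrow> real" where
  "offset x y m = (if m < card reps then ext_coord y (enum x m) - \<lfloor>ext_coord x (enum x m)\<rfloor> else 1)"

definition bary :: "real ^ 'n \<Rightarrow> real ^ 'n \<Rightarrow> nat \<Rightarrow> real" where
  "bary x y m = offset x y (Suc m) - offset x y m"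

definition wall :: "real ^ 'n \<Rightarrow> nat \<Rightarrow> 'n option \<times> 'n option \<times> int" where
  "wall x m = (enum x (Suc m mod card reps), enum x m,
    level x (enum x (Suc m mod card reps)) (enum x m))"

lemma
  assumes x: "x \<in> generic"
  shows bij_enum: "bij_betw (enum x) {..<card reps} reps"
    and enum_frac_less: "\<And>a b. a < b \<Longrightarrow> b < card reps \<Longrightarrow>
      frac (ext_coord x (enum x a)) < frac (ext_coord x (enum x b))"
proof -
  have inj: "inj_on (\<lambda>i. frac (ext_coord x i)) reps"
  proof (rule inj_onI, rule ccontr)
    fix i j assume ij: "i \<in> reps" "j \<in> reps" "frac (ext_coord x i) = frac (ext_coord x j)" "i \<noteq> j"
    then have "coord_diff x i j = of_int (\<lfloor>ext_coord x i\<rfloor> - \<lfloor>ext_coord x j\<rfloor>)"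
      by (simp add: frac_def coord_diff_def)
    with ij x show False
      by (metis Ints_of_int generic_iff)
  qed
  show "bij_betw (enum x) {..<card reps} reps"
    unfolding enum_def Let_def by (rule bij_betw_the_inv_into_sorted_nth[OF finite inj])
  show "frac (ext_coord x (enum x a)) < frac (ext_coord x (enum x b))"
    if "a < b" "b < card reps" for a b
    unfolding enum_def Let_def by (rule the_inv_into_sorted_nth_less[OF finite inj that])
qed

lemma enum_in_reps: "x \<in> generic \<Longrightarrow> a < card reps \<Longrightarrow> enum x a \<in> reps"
  using bij_enum bij_betwE by blast

lemma enum_eq_iff:
  "x \<in> generic \<Longrightarrow> a < card reps \<Longrightarrow> b < card reps \<Longrightarrow> enum x a = enum x b \<longleftrightarrow> a = b"
  using bij_betw_imp_inj_on[OF bij_enum] by (auto dest: inj_onD)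

lemma ex_enum_index:
  assumes "x \<in> generic" "i \<in> reps"
  obtains a where "a < card reps" "i = enum x a"
  using bij_enum[OF assms(1)] assms(2) unfolding bij_betw_def by (metis imageE lessThan_iff)

lemma enum_0:
  assumes x: "x \<in> generic"
  shows "enum x 0 = None"
proof -
  obtain a where a: "a < card reps" "None = enum x a"
    using ex_enum_index[OF x None_in_reps] .
  have "\<not> 0 < a"
    using enum_frac_less[OF x _ a(1), of 0] frac_ge_0[of "ext_coord x (enum x 0)"]
    by (auto simp: a(2)[symmetric])
  with a(2) show ?thesis by simp
qed

lemma offset_0: "x \<in> generic \<Longrightarrow> offset x y 0 = 0"
  by (simp add: offset_def enum_0)

lemma offset_card: "offset x y (card reps) = 1"
  by (simp add: offset_def)

lemma sum_bary_lessThan: "x \<in> generic \<Longrightarrow> (\<Sum>m<a. bary x y m) = offset x y a"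
  by (simp add: bary_def sum_lessThan_telescope offset_0)

lemma sum_bary: "x \<in> generic \<Longrightarrow> (\<Sum>m<card reps. bary x y m) = 1"
  by (simp add: sum_bary_lessThan offset_card)

lemma sum_bary_cyclic_ivl:
  assumes x: "x \<in> generic" and ab: "a < card reps" "b < card reps" "a \<noteq> b"
  shows "(\<Sum>m\<in>cyclic_ivl (card reps) b a. bary x y m) =
    offset x y a - offset x y b + of_bool (a < b)"
proof -
  have ivl: "(\<Sum>m=c..<d. bary x y m) = offset x y d - offset x y c" if "c \<le> d" for c d
    unfolding bary_def using that by (rule sum_Suc_diff')
  show ?thesis
  proof (cases "a < b")
    case True
    then have "{a..<b} \<subseteq> {..<card reps}"
      using ab by auto
    with True show ?thesis
      using sum_bary[OF x] by (simp add: cyclic_ivl_def sum_diff ivl)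
  next
    case False
    with ab show ?thesis
      by (simp add: cyclic_ivl_def ivl)
  qed
qed

lemma coord_diff_enum:
  assumes x: "x \<in> generic" and ab: "a < card reps" "b < card reps" "a \<noteq> b"
  shows "coord_diff y (enum x a) (enum x b) = level x (enum x a) (enum x b) +
    (\<Sum>m\<in>cyclic_ivl (card reps) b a. bary x y m)"
proof -
  have "frac (ext_coord x (enum x a)) < frac (ext_coord x (enum x b)) \<longleftrightarrow> a < b"
    using enum_frac_less[OF x, of a b] enum_frac_less[OF x, of b a] ab by (auto simp: neq_iff)
  then show ?thesis
    unfolding sum_bary_cyclic_ivl[OF assms]
    using ab by (simp add: offset_def coord_diff_def floor_diff_frac)
qed

lemma coord_diff_arc:
  assumes x: "x \<in> generic" and ij: "i \<in> reps" "j \<in> reps" "i \<noteq> j"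
  obtains M where "M \<noteq> {}" "M \<subseteq> {..<card reps}"
    "\<And>m. M = {m} \<Longrightarrow> wall x m = (i, j, level x i j)"
    "\<And>y. coord_diff y i j = level x i j + (\<Sum>m\<in>M. bary x y m)"
proof -
  obtain a b where a: "a < card reps" "i = enum x a" and b: "b < card reps" "j = enum x b"
    using ex_enum_index[OF x] ij by metis
  have ne: "a \<noteq> b"
    using a b ij by blast
  show ?thesis
  proof (rule that)
    show "cyclic_ivl (card reps) b a \<noteq> {}"
      using mem_cyclic_ivl_start[OF b(1)] by blast
    show "cyclic_ivl (card reps) b a \<subseteq> {..<card reps}"
      by (rule cyclic_ivl_subset[OF a(1)])
    show "wall x m = (i, j, level x i j)" if "cyclic_ivl (card reps) b a = {m}" for m
      using cyclic_ivl_singletonD[OF a(1) b(1) ne that] a(2) b(2) by (simp add: wall_def)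
    show "coord_diff y i j = level x i j + (\<Sum>m\<in>cyclic_ivl (card reps) b a. bary x y m)" for y
      unfolding a(2) b(2) by (rule coord_diff_enum[OF x a(1) b(1) ne])
  qed
qed

lemma wallD:
  assumes x: "x \<in> generic" and N: "1 < card reps" and m: "m < card reps"
    and w: "wall x m = (i, j, l)"
  shows "i \<in> reps" "j \<in> reps" "i \<noteq> j" "l = level x i j"
proof -
  have "Suc m mod card reps < card reps"
    using N by simp
  moreover have "Suc m mod card reps \<noteq> m"
    using N m by (cases "Suc m = card reps") auto
  ultimately show "i \<in> reps" "j \<in> reps" "i \<noteq> j" "l = level x i j"
    using w m enum_in_reps[OF x] enum_eq_iff[OF x] by (auto simp: wall_def)
qed

lemma bary_eq_wall:
  assumes x: "x \<in> generic" and N: "1 < card reps" and m: "m < card reps"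
    and w: "wall x m = (i, j, l)"
  shows "bary x y m = coord_diff y i j - l"
proof -
  have "Suc m mod card reps \<noteq> m"
    using N m by (cases "Suc m = card reps") auto
  then show ?thesis
    using coord_diff_enum[OF x _ m, of "Suc m mod card reps" y] w N m
    by (auto simp: wall_def cyclic_ivl_Suc_mod)
qed

lemma bary_eq_1: "x \<in> generic \<Longrightarrow> card reps = 1 \<Longrightarrow> bary x y 0 = 1"
  using sum_bary[of x y] by simp

lemma inj_on_wall: "x \<in> generic \<Longrightarrow> inj_on (wall x) {..<card reps}"
  by (rule inj_onI) (auto simp: wall_def enum_eq_iff)

lemma bary_toward: "bary x (y + e *\<^sub>R (z - y)) m = bary x y m + e * (bary x z m - bary x y m)"
proof -
  have "offset x (y + e *\<^sub>R (z - y)) k = offset x y k + e * (offset x z k - offset x y k)" for k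
    by (simp add: offset_def ext_coord_inner inner_add_right inner_diff_right)
  then show ?thesis
    by (simp add: bary_def algebra_simps)
qed

lemma bary_neg_iff:
  assumes x: "x \<in> generic" and m: "m < card reps"
  shows "bary x q m < 0 \<longleftrightarrow> wall x m \<in> separating q x"
proof -
  obtain i j l where w: "wall x m = (i, j, l)"
    by (cases "wall x m")
  consider "card reps = 1" | "1 < card reps"
    using m by linarith
  then show ?thesis
  proof cases
    case 1
    then have "i = j"
      using w m by (auto simp: wall_def)
    with 1 m w show ?thesis
      using bary_eq_1[OF x] by (auto simp: mem_separating_iff)
  next
    case 2
    note ij = wallD[OF x 2 m w]
    then show ?thesis
      using level_less[OF x ij(1-3)]
      by (simp add: bary_eq_wall[OF x 2 m w] w mem_separating_iff)
  qed
qed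

lemma bary_generic_nonzero:
  assumes x: "x \<in> generic" and z: "z \<in> generic" and m: "m < card reps"
  shows "bary x z m \<noteq> 0"
proof (cases "card reps = 1")
  case True
  with m bary_eq_1[OF x] show ?thesis by simp
next
  case False
  with m have N: "1 < card reps" by simp
  obtain i j l where w: "wall x m = (i, j, l)"
    by (cases "wall x m")
  then show ?thesis
    using wallD[OF x N m w] z bary_eq_wall[OF x N m w, of z]
    by (metis Ints_of_int eq_iff_diff_eq_0 generic_iff)
qed

lemma mem_closed_alcove_iff:
  assumes x: "x \<in> generic" and y: "y \<in> flat"
  shows "y \<in> closed_alcove x \<longleftrightarrow> (\<forall>m<card reps. 0 \<le> bary x y m)"
proof
  assume mem: "y \<in> closed_alcove x"
  show "\<forall>m<card reps. 0 \<le> bary x y m"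
  proof (intro allI impI, rule ccontr)
    fix m assume "m < card reps" "\<not> 0 \<le> bary x y m"
    then have "wall x m \<in> separating y x"
      using bary_neg_iff[OF x, of m y] by simp
    then show False
      using closed_alcove_lower[OF mem] unfolding wall_def mem_separating_iff by (meson not_less)
  qed
next
  assume nonneg: "\<forall>m<card reps. 0 \<le> bary x y m"
  show "y \<in> closed_alcove x"
  proof (rule closed_alcoveI[OF y])
    fix i j assume ij: "i \<in> reps" "j \<in> reps" "i \<noteq> j"
    obtain M where M: "M \<subseteq> {..<card reps}"
      "\<And>y. coord_diff y i j = level x i j + (\<Sum>m\<in>M. bary x y m)"
      using coord_diff_arc[OF x ij] by metis
    have "0 \<le> (\<Sum>m\<in>M. bary x y m)"
      using M(1) nonneg by (intro sum_nonneg) auto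
    moreover have "(\<Sum>m\<in>M. bary x y m) \<le> (\<Sum>m<card reps. bary x y m)"
      using M(1) nonneg by (intro sum_mono2) auto
    ultimately show "of_int (level x i j) \<le> coord_diff y i j"
      "coord_diff y i j \<le> of_int (level x i j) + 1"
      using sum_bary[OF x, of y] M(2)[of y] by linarith+
  qed
qed

lemma ex_bary:
  assumes x: "x \<in> generic" and w: "(\<Sum>m<card reps. w m) = 1"
  obtains y where "y \<in> flat" "\<And>m. m < card reps \<Longrightarrow> bary x y m = w m"
proof -
  define g where "g = (\<lambda>i. \<lfloor>ext_coord x i\<rfloor> + (\<Sum>k<inv_into {..<card reps} (enum x) i. w k))"
  have inv: "inv_into {..<card reps} (enum x) (enum x a) = a" if "a < card reps" for a
    using that bij_enum[OF x] by (simp add: bij_betw_def inv_into_f_f)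
  have "g None = 0"
    using inv[of 0] by (simp add: g_def enum_0[OF x])
  then obtain y where y: "y \<in> flat" "\<And>i. i \<in> reps \<Longrightarrow> ext_coord y i = g i"
    using ex_flat_point[of g] by auto
  have "offset x y m = (\<Sum>k<m. w k)" if "m \<le> card reps" for m
  proof (cases "m < card reps")
    case True
    with y(2)[OF enum_in_reps[OF x True]] inv[OF True] show ?thesis
      by (simp add: offset_def g_def)
  next
    case False
    with that w show ?thesis by (simp add: offset_def)
  qed
  then have "bary x y m = w m" if "m < card reps" for m
    using that by (simp add: bary_def)
  with y(1) show ?thesis by (rule that)
qed

lemma bary_inject:
  assumes x: "x \<in> generic" and y: "y \<in> flat" and z: "z \<in> flat"
    and eq: "\<And>m. m < card reps \<Longrightarrow> bary x y m = bary x z m"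
  shows "y = z"
proof -
  have coord: "ext_coord y i = ext_coord z i" if i: "i \<in> reps" for i
  proof -
    obtain a where a: "a < card reps" "i = enum x a"
      using ex_enum_index[OF x i] by metis
    have "offset x y a = offset x z a"
      unfolding sum_bary_lessThan[OF x, symmetric] using a eq by (intro sum.cong) auto
    with a show ?thesis by (simp add: offset_def)
  qed
  have "y $ m = z $ m" for m
  proof -
    obtain c :: int
      where c: "\<forall>y\<in>flat. coord_diff y (Some m) None = coord_diff y (rep (Some m)) None + c"
      using flat_coord_diff_rep[of "Some m" None] by auto
    show ?thesis
      using bspec[OF c y] bspec[OF c z] coord[of "rep (Some m)"] by (simp add: coord_diff_def)
  qed
  then show ?thesis
    by (simp add: vec_eq_iff)
qed

text \<open>Lower bounds suffice: the bound for \<open>(j, i)\<close> is an upper bound for \<open>(i, j)\<close>.\<close>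

definition just_beyond :: "real ^ 'n \<Rightarrow> nat \<Rightarrow> real ^ 'n \<Rightarrow> bool" where
  "just_beyond x m x' \<longleftrightarrow> x' \<in> flat \<and> (\<forall>i\<in>reps. \<forall>j\<in>reps. i \<noteq> j \<longrightarrow>
    (if wall x m = (i, j, level x i j)
     then of_int (level x i j) - 1 < coord_diff x' i j \<and> coord_diff x' i j < level x i j
     else level x i j < coord_diff x' i j))"

lemma
  assumes "just_beyond x m x'" "i \<in> reps" "j \<in> reps" "i \<noteq> j"
  shows just_beyond_on_wall: "wall x m = (i, j, level x i j) \<Longrightarrow>
      of_int (level x i j) - 1 < coord_diff x' i j \<and> coord_diff x' i j < level x i j"
    and just_beyond_off_wall: "wall x m \<noteq> (i, j, level x i j) \<Longrightarrow> level x i j < coord_diff x' i j"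
  using assms by (auto simp: just_beyond_def)

lemma ex_just_beyond:
  assumes x: "x \<in> generic" and N: "1 < card reps" and m: "m < card reps"
  obtains x' where "just_beyond x m x'"
proof -
  obtain w :: "nat \<Rightarrow> real" where w: "(\<Sum>k<card reps. w k) = 1" "- 1 < w m" "w m < 0"
    "\<forall>M. M \<noteq> {} \<and> M \<subseteq> {..<card reps} \<and> M \<noteq> {m} \<longrightarrow> 0 < sum w M"
    by (rule ex_weights_beyond_facet[OF N m])
  obtain x' where x': "x' \<in> flat" "\<And>k. k < card reps \<Longrightarrow> bary x x' k = w k"
    using ex_bary[OF x w(1)] by blast
  have "if wall x m = (i, j, level x i j)
      then of_int (level x i j) - 1 < coord_diff x' i j \<and> coord_diff x' i j < level x i j
      else level x i j < coord_diff x' i j"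
    if ij: "i \<in> reps" "j \<in> reps" "i \<noteq> j" for i j
  proof (cases "wall x m = (i, j, level x i j)")
    case True
    then show ?thesis
      using bary_eq_wall[OF x N m True, of x'] w(2,3) by (simp add: x'(2)[OF m])
  next
    case False
    obtain M where M: "M \<noteq> {}" "M \<subseteq> {..<card reps}"
      "\<And>m. M = {m} \<Longrightarrow> wall x m = (i, j, level x i j)"
      "\<And>y. coord_diff y i j = level x i j + (\<Sum>m\<in>M. bary x y m)"
      using coord_diff_arc[OF x ij] by metis
    have "(\<Sum>k\<in>M. bary x x' k) = sum w M"
      using M(2) x'(2) by (intro sum.cong) auto
    moreover have "M \<noteq> {m}"
      using M(3)[of m] False by blast
    then have "0 < sum w M"
      using w(4) M(1,2) by simp
    ultimately show ?thesis
      using M(4)[of x'] False by simp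
  qed
  with x'(1) show ?thesis
    by (intro that[of x']) (simp add: just_beyond_def)
qed

lemma separating_just_beyond:
  assumes x: "x \<in> generic" and N: "1 < card reps" and m: "m < card reps"
    and x': "just_beyond x m x'"
  shows "separating x' x = {wall x m}"
proof -
  have "h = wall x m" if h: "h \<in> separating x' x" for h
  proof -
    obtain i j l where ijl: "h = (i, j, l)"
      by (cases h)
    note sep = mem_separatingD[OF h[unfolded ijl]]
    have "l \<le> level x i j"
      using sep(5) by linarith
    then have wall: "wall x m = (i, j, level x i j)"
      using just_beyond_off_wall[OF x' sep(1-3)] sep(4) by fastforce
    moreover have "level x i j \<le> l"
      using just_beyond_on_wall[OF x' sep(1-3) wall] sep(4) by linarith
    ultimately show ?thesis
      using \<open>l \<le> level x i j\<close> ijl by simp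
  qed
  moreover have "wall x m \<in> separating x' x"
  proof -
    obtain i j l where w: "wall x m = (i, j, l)"
      by (cases "wall x m")
    note ij = wallD[OF x N m w]
    then show ?thesis
      using just_beyond_on_wall[OF x' ij(1-3)] level_less[OF x ij(1-3)]
      by (simp add: w mem_separating_iff)
  qed
  ultimately show ?thesis
    by blast
qed

lemma just_beyond_not_Ints:
  assumes x: "x \<in> generic" and x': "just_beyond x m x'" and ij: "i \<in> reps" "j \<in> reps" "i \<noteq> j"
  shows "coord_diff x' i j \<notin> \<int>"
proof -
  have on_wall: "coord_diff x' i j \<notin> \<int>"
    if "i \<in> reps" "j \<in> reps" "i \<noteq> j" "wall x m = (i, j, level x i j)" for i j
    using just_beyond_on_wall[OF x' that] by (intro between_not_Ints[of "level x i j - 1"]) simp_all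
  consider "wall x m = (i, j, level x i j)" | "wall x m = (j, i, level x j i)" |
    "wall x m \<noteq> (i, j, level x i j)" "wall x m \<noteq> (j, i, level x j i)"
    by blast
  then show ?thesis
  proof cases
    case 1
    with on_wall ij show ?thesis by blast
  next
    case 2
    with on_wall[of j i] ij show ?thesis
      by (simp add: coord_diff_swap[of x' i j])
  next
    case 3
    then have "level x i j < coord_diff x' i j" "level x j i < coord_diff x' j i"
      using just_beyond_off_wall[OF x'] ij by blast+
    then show ?thesis
      using level_swap[OF x ij]
      by (intro between_not_Ints[of "level x i j"]) (simp_all add: coord_diff_swap[of x' i j])
  qed
qed

text \<open>The point \<open>q\<close> is needed to see that the wall is not on the boundary of the polytope.\<close>

lemma ex_neighbour_beyond_wall:
  assumes q: "q \<in> P" and x: "x \<in> generic"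
    and m: "m < card reps" and sep: "wall x m \<in> separating q x"
  obtains x' where "x' \<in> generic" "separating x' x = {wall x m}"
proof -
  have "1 < card reps"
    using sep m by (cases "card reps = 1") (auto simp: wall_def mem_separating_iff)
  then obtain x' where x': "just_beyond x m x'" "separating x' x = {wall x m}"
    using ex_just_beyond[OF x _ m] separating_just_beyond[OF x _ m] by metis
  then have flat: "x' \<in> flat"
    by (simp add: just_beyond_def)
  have "x' \<in> P"
  proof (rule mem_P_if_reps_halfspaces[OF flat], rule ccontr)
    fix i j l assume ij: "i \<in> reps" "j \<in> reps" "i \<noteq> j"
      and le: "\<And>x. x \<in> P \<Longrightarrow> coord_diff x i j \<le> of_int l" and gt: "\<not> coord_diff x' i j \<le> of_int l"
    have "coord_diff x i j \<noteq> of_int l"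
      using x ij by (metis Ints_of_int generic_iff)
    then have "(j, i, - l) \<in> separating x' x"
      using gt le[OF generic_in_P[OF x]] ij
      by (simp add: mem_separating_iff coord_diff_swap[of _ i j])
    then have "(j, i, - l) \<in> separating q x"
      using x'(2) sep by simp
    then show False
      using le[OF q] by (simp add: mem_separating_iff coord_diff_swap[of _ i j])
  qed
  then have "x' \<in> generic"
    using just_beyond_not_Ints[OF x x'(1)] by (simp add: generic_iff)
  then show ?thesis
    using x'(2) by (rule that)
qed

lemma ex_wall_between:
  assumes x: "x \<in> generic" and z: "z \<in> generic" and ne: "closed_alcove z \<noteq> closed_alcove x"
  obtains m where "m < card reps" "wall x m \<in> separating z x"
proof -
  have "z \<notin> closed_alcove x"
    using generic_closed_alcove_eq[OF x z] ne by blast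
  then obtain m where "m < card reps" "bary x z m < 0"
    using mem_closed_alcove_iff[OF x generic_in_flat[OF z]] by (auto simp: not_le)
  then show ?thesis
    using bary_neg_iff[OF x] by (intro that) blast+
qed

lemma adjacent_imp_wall:
  assumes x: "x \<in> generic" and z: "z \<in> generic" and sep: "separating z x = {h}"
  obtains m where "m < card reps" "h = wall x m"
proof -
  have "closed_alcove z \<noteq> closed_alcove x"
    using sep separating_empty_iff[OF z x] by auto
  then show ?thesis
    using ex_wall_between[OF x z] sep that by (metis singletonD)
qed

lemma graph_dist_eq_card_separating:
  assumes q: "q \<in> generic" and x: "x \<in> generic"
  shows "graph_dist adjacency (closed_alcove q) (closed_alcove x) = card (separating q x)"
proof -
  define f where "f F = card (separating q (inv_into generic closed_alcove F))" for F
  have f: "f (closed_alcove z) = card (separating q z)" if "z \<in> generic" for z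
    unfolding f_def using that
    by (intro arg_cong[where f = card] separating_cong) (auto simp: inv_into_into f_inv_into_f)
  have "graph_dist adjacency (closed_alcove q) (closed_alcove x) = f (closed_alcove x)"
  proof (rule graph_dist_eqI[where V = "closed_alcove ` generic"])
    show "f (closed_alcove q) = 0"
      using separating_empty_iff[OF q q] by (simp add: f[OF q])
    show "f G \<le> Suc (f F)" if edge: "(F, G) \<in> adjacency" for F G
    proof -
      obtain y z where yz: "y \<in> generic" "z \<in> generic" "F = closed_alcove y" "G = closed_alcove z"
        using edge by (auto simp: dual_graph_def)
      with edge obtain h where "separating y z = {h}"
        using adjacency_iff_separating_singleton by blast
      then show ?thesis
        using card_separating_adjacent(1) yz f by simp
    qed
    show "\<exists>F\<in>closed_alcove ` generic. (F, G) \<in> adjacency \<and> f G = Suc (f F)"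
      if G: "G \<in> closed_alcove ` generic" "G \<noteq> closed_alcove q" for G
    proof -
      obtain z where z: "z \<in> generic" "G = closed_alcove z"
        using G(1) by blast
      obtain m where m: "m < card reps" "wall z m \<in> separating q z"
        using ex_wall_between[OF z(1) q] G(2) z(2) by metis
      obtain y where y: "y \<in> generic" "separating y z = {wall z m}"
        using ex_neighbour_beyond_wall[OF generic_in_P[OF q] z(1) m] .
      then have "(closed_alcove y, G) \<in> adjacency"
        using adjacency_iff_separating_singleton[OF y(1) z(1)] z(2) by blast
      moreover have "f G = Suc (f (closed_alcove y))"
        using card_separating_adjacent(2)[OF y(1) z(1) y(2), of q] m(2) z f[OF y(1)] f[OF z(1)]
        by simp
      ultimately show ?thesis
        using y(1) by blast
    qed
  qed (use x in blast)
  then show ?thesis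
    by (simp add: f[OF x])
qed

definition visible :: "real ^ 'n \<Rightarrow> real ^ 'n \<Rightarrow> nat set" where
  "visible q x = {m. m < card reps \<and> bary x q m < 0}"

lemma visible_subset: "visible q x \<subseteq> {..<card reps}"
  by (auto simp: visible_def)

lemma mem_visible_iff:
  "x \<in> generic \<Longrightarrow> m \<in> visible q x \<longleftrightarrow> m < card reps \<and> wall x m \<in> separating q x"
  using bary_neg_iff by (auto simp: visible_def)

lemma visible_empty_iff:
  assumes "q \<in> generic" "x \<in> generic"
  shows "visible q x = {} \<longleftrightarrow> closed_alcove x = closed_alcove q"
proof -
  have "visible q x = {} \<longleftrightarrow> q \<in> closed_alcove x"
    unfolding mem_closed_alcove_iff[OF assms(2) generic_in_flat[OF assms(1)]]
    by (force simp: visible_def simp flip: not_less)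
  also have "\<dots> \<longleftrightarrow> closed_alcove x = closed_alcove q"
    using generic_closed_alcove_eq[OF assms(2,1)] mem_closed_alcove_self[OF assms(1)] by blast
  finally show ?thesis .
qed

definition arcs_into ::
  "real ^ 'n \<Rightarrow> (real ^ 'n) set \<Rightarrow> ((real ^ 'n) set \<times> (real ^ 'n) set) set" where
  "arcs_into q F = incoming_arcs (orientation_away adjacency (closed_alcove q)) F"

lemma mem_arcs_into_iff:
  assumes q: "q \<in> generic" and x: "x \<in> generic" and z: "z \<in> generic"
  shows "(closed_alcove z, closed_alcove x) \<in> arcs_into q (closed_alcove x) \<longleftrightarrow>
    (\<exists>m\<in>visible q x. separating z x = {wall x m})"
proof -
  have "(closed_alcove z, closed_alcove x) \<in> arcs_into q (closed_alcove x) \<longleftrightarrow>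
      (\<exists>h. separating z x = {h} \<and> card (separating q x) = Suc (card (separating q z)))"
    using adjacency_iff_separating_singleton[OF z x]
    by (auto simp: arcs_into_def incoming_arcs_def orientation_away_def
        graph_dist_eq_card_separating[OF q] x z)
  also have "\<dots> \<longleftrightarrow> (\<exists>h. separating z x = {h} \<and> h \<in> separating q x)"
    using card_separating_adjacent(2)[OF z x] by blast
  also have "\<dots> \<longleftrightarrow> (\<exists>m\<in>visible q x. separating z x = {wall x m})"
    using adjacent_imp_wall[OF x z] mem_visible_iff[OF x] by metis
  finally show ?thesis .
qed

lemma card_arcs_into:
  assumes q: "q \<in> generic" and x: "x \<in> generic"
  shows "card (arcs_into q (closed_alcove x)) = card (visible q x)"
proof -
  have "\<forall>m\<in>visible q x. \<exists>z. z \<in> generic \<and> separating z x = {wall x m}"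
    using ex_neighbour_beyond_wall[OF generic_in_P[OF q] x] mem_visible_iff[OF x] by metis
  then obtain neighbour where neighbour: "\<And>m. m \<in> visible q x \<Longrightarrow> neighbour m \<in> generic"
    "\<And>m. m \<in> visible q x \<Longrightarrow> separating (neighbour m) x = {wall x m}"
    by metis
  define arc where "arc m = (closed_alcove (neighbour m), closed_alcove x)" for m
  have "inj_on arc (visible q x)"
  proof (rule inj_onI)
    fix m m' assume m: "m \<in> visible q x" "m' \<in> visible q x" and "arc m = arc m'"
    then have "separating x (neighbour m) = separating x (neighbour m')"
      by (intro separating_cong neighbour) (auto simp: arc_def)
    then have "separating (neighbour m) x = separating (neighbour m') x"
      by (simp add: separating_swap[of _ x])
    then have "wall x m = wall x m'"
      using neighbour(2) m by simp
    then show "m = m'"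
      using inj_on_wall[OF x] m visible_subset by (meson inj_on_def subsetD)
  qed
  moreover have "arc ` visible q x = arcs_into q (closed_alcove x)"
  proof (intro subset_antisym subsetI)
    fix a assume "a \<in> arc ` visible q x"
    then show "a \<in> arcs_into q (closed_alcove x)"
      using mem_arcs_into_iff[OF q x] neighbour by (auto simp: arc_def)
  next
    fix a assume a: "a \<in> arcs_into q (closed_alcove x)"
    then obtain z where z: "z \<in> generic" "a = (closed_alcove z, closed_alcove x)"
      by (auto simp: arcs_into_def incoming_arcs_def orientation_away_def dual_graph_def)
    then obtain m where m: "m \<in> visible q x" "separating z x = {wall x m}"
      using mem_arcs_into_iff[OF q x z(1)] a by blast
    have "closed_alcove z = closed_alcove (neighbour m)"
      by (rule separating_singleton_inject[OF x z(1) neighbour(1)[OF m(1)] m(2)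
            neighbour(2)[OF m(1)]])
    with z(2) m(1) show "a \<in> arc ` visible q x"
      by (auto simp: arc_def)
  qed
  ultimately show ?thesis
    by (metis card_image)
qed

end

section \<open>Counting lattice points\<close>

lemma fps_multichoose_mult_one_minus_fps_X_power:
  "Abs_fps (\<lambda>t. of_nat ((t + N - 1) choose t)) * (1 - fps_X) ^ N = (1 :: 'a::comm_ring_1 fps)"
proof (induction N)
  case 0
  have "Abs_fps (\<lambda>t. of_nat ((t - 1) choose t)) = (1 :: 'a fps)"
    by (rule fps_ext) (auto simp: binomial_eq_0)
  then show ?case by simp
next
  case (Suc N)
  define F :: "nat \<Rightarrow> 'a fps" where "F = (\<lambda>N. Abs_fps (\<lambda>t. of_nat ((t + N - 1) choose t)))"
  have "F (Suc N) * (1 - fps_X) = F N"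
  proof (rule fps_ext)
    fix t
    show "fps_nth (F (Suc N) * (1 - fps_X)) t = fps_nth (F N) t"
      by (cases t) (simp_all add: F_def right_diff_distrib)
  qed
  then have "F (Suc N) * (1 - fps_X) ^ Suc N = F N * (1 - fps_X) ^ N"
    by (simp add: mult.assoc[symmetric])
  with Suc.IH show ?case
    by (simp only: F_def)
qed

definition shifted_compositions :: "nat \<Rightarrow> nat \<Rightarrow> nat \<Rightarrow> nat list set" where
  "shifted_compositions N k t = {xs. length xs = N \<and> sum_list xs + k = t}"

lemma finite_shifted_compositions: "finite (shifted_compositions N k t)"
proof (rule finite_subset)
  show "shifted_compositions N k t \<subseteq> {xs. set xs \<subseteq> {..t} \<and> length xs = N}"
    using member_le_sum_list by (fastforce simp: shifted_compositions_def)
  show "finite {xs. set xs \<subseteq> {..t} \<and> length xs = N}"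
    by (intro finite_lists_length_eq finite_atMost)
qed

lemma card_shifted_compositions:
  "card (shifted_compositions N k t) = (if k \<le> t then (t - k + N - 1) choose (t - k) else 0)"
proof (cases "k \<le> t")
  case True
  then have "shifted_compositions N k t = {xs. length xs = N \<and> sum_list xs = t - k}"
    by (auto simp: shifted_compositions_def)
  with True show ?thesis
    by (simp only: card_length_sum_list if_True)
qed (simp add: shifted_compositions_def)

lemma fps_card_shifted_compositions:
  "Abs_fps (\<lambda>t. of_nat (card (shifted_compositions N k t))) * (1 - fps_X) ^ N =
    (fps_X ^ k :: 'a::comm_ring_1 fps)"
proof -
  have "Abs_fps (\<lambda>t. of_nat (card (shifted_compositions N k t))) =
      fps_X ^ k * (Abs_fps (\<lambda>t. of_nat ((t + N - 1) choose t)) :: 'a fps)"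
    by (rule fps_ext) (simp add: card_shifted_compositions fps_X_power_mult_nth)
  then show ?thesis
    by (simp only: mult.assoc mult_1_right fps_multichoose_mult_one_minus_fps_X_power)
qed

lemma tendsto_toward:
  fixes a b :: real
  shows "((\<lambda>e. a + e * (b - a)) \<longlongrightarrow> a) (at_right 0)"
proof -
  have "((\<lambda>e. a + e * (b - a)) \<longlongrightarrow> a + 0 * (b - a)) (at_right 0)"
    by (intro tendsto_intros)
  then show ?thesis by simp
qed

lemma eventually_less_toward:
  fixes a b c :: real
  assumes "c < a \<or> a = c \<and> c < b"
  shows "\<forall>\<^sub>F e in at_right 0. c < a + e * (b - a)"
proof (cases "c < a")
  case True
  then show ?thesis
    by (rule order_tendstoD(1)[OF tendsto_toward])
next
  case False
  then have "a = c" "c < b"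
    using assms by auto
  from eventually_at_right_less[of "0 :: real"] show ?thesis
    by eventually_elim (simp add: \<open>a = c\<close> \<open>c < b\<close>)
qed

lemma eventually_toward_less:
  fixes a b c :: real
  assumes "a < c \<or> a = c \<and> b < c"
  shows "\<forall>\<^sub>F e in at_right 0. a + e * (b - a) < c"
proof -
  have "\<forall>\<^sub>F e in at_right 0. - c < - a + e * (- b - - a)"
    using assms by (intro eventually_less_toward) auto
  then show ?thesis
    by eventually_elim (simp add: algebra_simps)
qed

lemma eventually_toward_nonneg_iff:
  fixes a b :: real
  assumes "b \<noteq> 0"
  shows "(\<forall>\<^sub>F e in at_right 0. 0 \<le> a + e * (b - a)) \<longleftrightarrow> 0 < a \<or> a = 0 \<and> 0 < b"
proof
  assume "0 < a \<or> a = 0 \<and> 0 < b"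
  then show "\<forall>\<^sub>F e in at_right 0. 0 \<le> a + e * (b - a)"
    using eventually_less_toward[of 0 a b] by (intro eventually_mono[OF _ less_imp_le]) auto
next
  assume nonneg: "\<forall>\<^sub>F e in at_right 0. 0 \<le> a + e * (b - a)"
  show "0 < a \<or> a = 0 \<and> 0 < b"
  proof (rule ccontr)
    assume "\<not> (0 < a \<or> a = 0 \<and> 0 < b)"
    then have "\<forall>\<^sub>F e in at_right 0. a + e * (b - a) < 0"
      using assms by (intro eventually_toward_less) auto
    with nonneg have "\<forall>\<^sub>F e in at_right (0::real). False"
      by eventually_elim simp
    then show False by simp
  qed
qed

lemma eventually_toward_in_unit_interval:
  fixes a b :: real
  assumes "b \<notin> \<int>"
  obtains n :: int where
    "\<forall>\<^sub>F e in at_right 0. of_int n < a + e * (b - a) \<and> a + e * (b - a) < of_int n + 1"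
proof (cases "b < a")
  case True
  have "of_int (\<lceil>a\<rceil> - 1) < a \<and> a \<le> of_int (\<lceil>a\<rceil> - 1) + 1"
    using ceiling_correct[of a] by simp
  with True have "of_int (\<lceil>a\<rceil> - 1) < a"
    "a < of_int (\<lceil>a\<rceil> - 1) + 1 \<or> a = of_int (\<lceil>a\<rceil> - 1) + 1 \<and> b < of_int (\<lceil>a\<rceil> - 1) + 1"
    by linarith+
  then show ?thesis
    by (intro that[of "\<lceil>a\<rceil> - 1"] eventually_conj eventually_less_toward eventually_toward_less)
      blast+
next
  case False
  have "of_int \<lfloor>a\<rfloor> < a \<or> a = of_int \<lfloor>a\<rfloor> \<and> of_int \<lfloor>a\<rfloor> < b"
    using False assms of_int_floor_le[of a] by (metis Ints_of_int less_le not_less)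
  then show ?thesis
    by (intro that[of "\<lfloor>a\<rfloor>"] eventually_conj eventually_less_toward eventually_toward_less) auto
qed

lemma eventually_toward_floor:
  fixes a b :: real
  assumes "b \<notin> \<int>"
  obtains n where "\<forall>\<^sub>F e in at_right 0. a + e * (b - a) \<notin> \<int> \<and> \<lfloor>a + e * (b - a)\<rfloor> = n"
proof -
  obtain n :: int where
    "\<forall>\<^sub>F e in at_right 0. of_int n < a + e * (b - a) \<and> a + e * (b - a) < of_int n + 1"
    by (rule eventually_toward_in_unit_interval[OF assms])
  then have "\<forall>\<^sub>F e in at_right 0. a + e * (b - a) \<notin> \<int> \<and> \<lfloor>a + e * (b - a)\<rfloor> = n"
    by eventually_elim (auto dest: between_not_Ints intro: floor_unique)
  then show ?thesis by (rule that)
qed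

lemma eventually_toward_in_convex:
  fixes x y :: "'a::real_vector"
  assumes "convex S" "x \<in> S" "y \<in> S"
  shows "\<forall>\<^sub>F e in at_right 0. x + e *\<^sub>R (y - x) \<in> S"
  using eventually_at_right_real[of 0 "1::real", simplified]
proof eventually_elim
  case (elim e)
  then have "(1 - e) *\<^sub>R x + e *\<^sub>R y \<in> S"
    by (intro convexD_alt assms) auto
  then show ?case
    by (simp add: algebra_simps)
qed

context alcoved_polytope
begin

lemma eventually_toward_level:
  assumes q: "q \<in> generic" and y: "y \<in> P"
  obtains n where "\<forall>\<^sub>F e in at_right 0. y + e *\<^sub>R (q - y) \<in> generic \<and>
    (\<forall>i\<in>reps. \<forall>j\<in>reps. level (y + e *\<^sub>R (q - y)) i j = n i j)"
proof -
  define settles where "settles i j n \<longleftrightarrow> (\<forall>\<^sub>F e in at_right 0.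
    (i \<noteq> j \<longrightarrow> coord_diff (y + e *\<^sub>R (q - y)) i j \<notin> \<int>) \<and> level (y + e *\<^sub>R (q - y)) i j = n)" for i j n
  have "\<exists>n. settles i j n" if "i \<in> reps" "j \<in> reps" for i j
  proof (cases "i = j")
    case False
    then have "coord_diff q i j \<notin> \<int>"
      using q that by (simp add: generic_iff)
    then obtain n where "\<forall>\<^sub>F e in at_right 0. coord_diff (y + e *\<^sub>R (q - y)) i j \<notin> \<int> \<and>
        level (y + e *\<^sub>R (q - y)) i j = n"
      unfolding coord_diff_toward by (rule eventually_toward_floor)
    with False show ?thesis
      by (auto simp: settles_def)
  qed (simp add: settles_def)
  then obtain n where "\<forall>i\<in>reps. \<forall>j\<in>reps. settles i j (n i j)"
    by metis
  then have "\<forall>\<^sub>F e in at_right 0. \<forall>i\<in>reps. \<forall>j\<in>reps.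
      (i \<noteq> j \<longrightarrow> coord_diff (y + e *\<^sub>R (q - y)) i j \<notin> \<int>) \<and> level (y + e *\<^sub>R (q - y)) i j = n i j"
    by (simp add: eventually_ball_finite_distrib settles_def)
  moreover have "\<forall>\<^sub>F e in at_right 0. y + e *\<^sub>R (q - y) \<in> P"
    by (intro eventually_toward_in_convex polytope_imp_convex polytope y generic_in_P q)
  ultimately have "\<forall>\<^sub>F e in at_right 0. y + e *\<^sub>R (q - y) \<in> generic \<and>
      (\<forall>i\<in>reps. \<forall>j\<in>reps. level (y + e *\<^sub>R (q - y)) i j = n i j)"
    by eventually_elim (simp add: generic_iff)
  then show ?thesis by (rule that)
qed

lemma eventually_toward_closed_alcove:
  assumes q: "q \<in> generic" and y: "y \<in> P"
  obtains F where "F \<in> closed_alcove ` generic"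
    "\<forall>\<^sub>F e in at_right 0. y + e *\<^sub>R (q - y) \<in> generic \<and> closed_alcove (y + e *\<^sub>R (q - y)) = F"
proof -
  obtain n where level: "\<forall>\<^sub>F e in at_right 0. y + e *\<^sub>R (q - y) \<in> generic \<and>
      (\<forall>i\<in>reps. \<forall>j\<in>reps. level (y + e *\<^sub>R (q - y)) i j = n i j)"
    by (rule eventually_toward_level[OF q y])
  then obtain e where e: "y + e *\<^sub>R (q - y) \<in> generic"
      "\<forall>i\<in>reps. \<forall>j\<in>reps. level (y + e *\<^sub>R (q - y)) i j = n i j"
    using eventually_happens'[OF trivial_limit_at_right_real] by blast
  from level have "\<forall>\<^sub>F e' in at_right 0. y + e' *\<^sub>R (q - y) \<in> generic \<and>
      closed_alcove (y + e' *\<^sub>R (q - y)) = closed_alcove (y + e *\<^sub>R (q - y))"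
    by eventually_elim (use e(2) in \<open>simp add: closed_alcove_cong\<close>)
  with e(1) show ?thesis
    by (intro that) auto
qed

definition half_open :: "real ^ 'n \<Rightarrow> (real ^ 'n) set \<Rightarrow> (real ^ 'n) set" where
  "half_open q F = {y \<in> P. \<forall>\<^sub>F e in at_right 0. y + e *\<^sub>R (q - y) \<in> F}"

lemma Union_half_open:
  assumes q: "q \<in> generic"
  shows "(\<Union>F\<in>closed_alcove ` generic. half_open q F) = P"
proof (intro subset_antisym subsetI)
  fix y assume y: "y \<in> P"
  obtain F where F: "F \<in> closed_alcove ` generic"
    "\<forall>\<^sub>F e in at_right 0. y + e *\<^sub>R (q - y) \<in> generic \<and> closed_alcove (y + e *\<^sub>R (q - y)) = F"
    by (rule eventually_toward_closed_alcove[OF q y])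
  from F(2) have "\<forall>\<^sub>F e in at_right 0. y + e *\<^sub>R (q - y) \<in> F"
    by eventually_elim (use mem_closed_alcove_self in blast)
  with F(1) y show "y \<in> (\<Union>F\<in>closed_alcove ` generic. half_open q F)"
    unfolding half_open_def by blast
qed (auto simp: half_open_def)

lemma half_open_disjoint:
  assumes q: "q \<in> generic" and F: "F \<in> closed_alcove ` generic" and G: "G \<in> closed_alcove ` generic"
    and "F \<noteq> G"
  shows "half_open q F \<inter> half_open q G = {}"
proof (rule equals0I)
  fix y assume y: "y \<in> half_open q F \<inter> half_open q G"
  then obtain H where "\<forall>\<^sub>F e in at_right 0. y + e *\<^sub>R (q - y) \<in> generic \<and>
      closed_alcove (y + e *\<^sub>R (q - y)) = H"
    using eventually_toward_closed_alcove[OF q, of y] by (auto simp: half_open_def)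
  moreover have "\<forall>\<^sub>F e in at_right 0. y + e *\<^sub>R (q - y) \<in> F"
    "\<forall>\<^sub>F e in at_right 0. y + e *\<^sub>R (q - y) \<in> G"
    using y by (simp_all add: half_open_def)
  ultimately have "\<forall>\<^sub>F e in at_right (0::real). F = G"
    by eventually_elim (use F G generic_closed_alcove_eq in blast)
  with \<open>F \<noteq> G\<close> show False by simp
qed

lemma mem_half_open_iff:
  assumes q: "q \<in> generic" and x: "x \<in> generic" and y: "y \<in> flat"
  shows "y \<in> half_open q (closed_alcove x) \<longleftrightarrow>
    (\<forall>m<card reps. 0 \<le> bary x y m) \<and> (\<forall>m\<in>visible q x. 0 < bary x y m)"
proof -
  have "(\<forall>\<^sub>F e in at_right 0. y + e *\<^sub>R (q - y) \<in> closed_alcove x) \<longleftrightarrow>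
      (\<forall>\<^sub>F e in at_right 0. \<forall>m\<in>{..<card reps}. 0 \<le> bary x y m + e * (bary x q m - bary x y m))"
    by (simp add: mem_closed_alcove_iff[OF x toward_in_flat[OF y generic_in_flat[OF q]]]
        bary_toward Ball_def)
  also have "\<dots> \<longleftrightarrow> (\<forall>m\<in>{..<card reps}. 0 < bary x y m \<or> bary x y m = 0 \<and> 0 < bary x q m)"
    using bary_generic_nonzero[OF x q]
    by (simp add: eventually_ball_finite_distrib eventually_toward_nonneg_iff)
  also have "\<dots> \<longleftrightarrow> (\<forall>m\<in>{..<card reps}. 0 \<le> bary x y m \<and> (m \<in> visible q x \<longrightarrow> 0 < bary x y m))"
  proof (intro ball_cong refl)
    fix m assume m: "m \<in> {..<card reps}"
    then have "bary x q m < 0 \<or> 0 < bary x q m"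
      using bary_generic_nonzero[OF x q, of m] by (simp add: neq_iff)
    with m show "0 < bary x y m \<or> bary x y m = 0 \<and> 0 < bary x q m \<longleftrightarrow>
        0 \<le> bary x y m \<and> (m \<in> visible q x \<longrightarrow> 0 < bary x y m)"
      by (auto simp: visible_def)
  qed
  also have "\<dots> \<longleftrightarrow> (\<forall>m<card reps. 0 \<le> bary x y m) \<and> (\<forall>m\<in>visible q x. 0 < bary x y m)"
    using visible_subset[of q x] by (auto simp: subset_iff)
  finally show ?thesis
    using mem_closed_alcove_iff[OF x y] closed_alcove_subset[OF x] by (auto simp: half_open_def)
qed

lemma half_open_subset_flat: "half_open q F \<subseteq> flat"
  using P_subset_flat by (auto simp: half_open_def)

definition fractional :: "nat \<Rightarrow> (real ^ 'n) set" where
  "fractional t = {y. \<forall>i. real t * y $ i \<in> \<int>}"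

lemma fractional_iff_bary:
  assumes x: "x \<in> generic" and y: "y \<in> flat"
  shows "y \<in> fractional t \<longleftrightarrow> (\<forall>m<card reps. real t * bary x y m \<in> \<int>)"
proof
  assume frac: "y \<in> fractional t"
  have "real t * ext_coord y i \<in> \<int>" for i
    using frac by (cases i) (simp_all add: fractional_def)
  then have "real t * offset x y k \<in> \<int>" for k
    by (simp add: offset_def right_diff_distrib)
  then show "\<forall>m<card reps. real t * bary x y m \<in> \<int>"
    by (simp add: bary_def right_diff_distrib)
next
  assume int: "\<forall>m<card reps. real t * bary x y m \<in> \<int>"
  have "real t * ext_coord y i \<in> \<int>" if i: "i \<in> reps" for i
  proof -
    obtain k where k: "k < card reps" "i = enum x k"
      using ex_enum_index[OF x i] .
    have "ext_coord y i = (\<Sum>m<k. bary x y m) + \<lfloor>ext_coord x i\<rfloor>"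
      using k by (simp add: sum_bary_lessThan[OF x] offset_def)
    then have "real t * ext_coord y i = (\<Sum>m<k. real t * bary x y m) + real t * \<lfloor>ext_coord x i\<rfloor>"
      by (simp add: distrib_left sum_distrib_left)
    also have "\<dots> \<in> \<int>"
      using int k(1) by (intro Ints_add Ints_sum Ints_mult[OF Ints_of_nat Ints_of_int]) auto
    finally show ?thesis .
  qed
  moreover have "\<exists>c::int. y $ m = ext_coord y (rep (Some m)) + c" for m
    using flat_coord_diff_rep[of "Some m" None] y by (auto simp: coord_diff_def)
  ultimately have "real t * y $ m \<in> \<int>" for m
    by (metis Ints_add Ints_mult Ints_of_int Ints_of_nat distrib_left rep_in_reps)
  then show "y \<in> fractional t"
    by (simp add: fractional_def)
qed

lemma sum_nth_add_of_bool_visible: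
  assumes "length xs = card reps"
  shows "(\<Sum>m<card reps. real (xs ! m) + of_bool (m \<in> visible q x)) =
    real (sum_list xs + card (visible q x))"
proof -
  have "(\<Sum>m<card reps. of_bool (m \<in> visible q x)) = real (card (visible q x))"
    using visible_subset[of q x] by (simp add: sum_of_bool_eq Int_absorb1)
  then show ?thesis
    using assms by (simp add: sum.distrib sum_list_sum_nth atLeast0LessThan)
qed

text \<open>The lattice points of a dilated half-open simplex correspond to the lists of their barycentric
  coordinates, diminished by 1 at the removed facets.\<close>

definition slack_list :: "nat \<Rightarrow> real ^ 'n \<Rightarrow> real ^ 'n \<Rightarrow> real ^ 'n \<Rightarrow> nat list" where
  "slack_list t q x y =
    map (\<lambda>m. nat \<lfloor>real t * bary x y m\<rfloor> - of_bool (m \<in> visible q x)) [0..<card reps]"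

lemma length_slack_list [simp]: "length (slack_list t q x y) = card reps"
  by (simp add: slack_list_def)

lemma nth_slack_list:
  assumes q: "q \<in> generic" and x: "x \<in> generic" and t: "0 < t"
    and y: "y \<in> fractional t \<inter> half_open q (closed_alcove x)" and m: "m < card reps"
  shows "real (slack_list t q x y ! m) + of_bool (m \<in> visible q x) = real t * bary x y m"
proof -
  have flat: "y \<in> flat"
    using y half_open_subset_flat by blast
  obtain z where z: "real t * bary x y m = of_int z"
    using y m fractional_iff_bary[OF x flat, of t] by (auto elim: Ints_cases)
  have "0 \<le> bary x y m" "m \<in> visible q x \<Longrightarrow> 0 < bary x y m"
    using y m mem_half_open_iff[OF q x flat] by auto
  then have "0 \<le> real_of_int z" "m \<in> visible q x \<Longrightarrow> 0 < real_of_int z"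
    using t by (simp_all flip: z)
  then show ?thesis
    using m by (auto simp: slack_list_def z)
qed

lemma inj_on_slack_list:
  assumes q: "q \<in> generic" and x: "x \<in> generic" and t: "0 < t"
  shows "inj_on (slack_list t q x) (fractional t \<inter> half_open q (closed_alcove x))"
proof (rule inj_onI)
  fix y z assume y: "y \<in> fractional t \<inter> half_open q (closed_alcove x)"
    and z: "z \<in> fractional t \<inter> half_open q (closed_alcove x)"
    and eq: "slack_list t q x y = slack_list t q x z"
  have "real t * bary x y m = real t * bary x z m" if "m < card reps" for m
    unfolding nth_slack_list[OF q x t y that, symmetric]
      nth_slack_list[OF q x t z that, symmetric] eq ..
  with t y z half_open_subset_flat show "y = z"
    by (intro bary_inject[OF x]) auto
qed

lemma slack_list_in_shifted_compositions:
  assumes q: "q \<in> generic" and x: "x \<in> generic" and t: "0 < t"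
    and y: "y \<in> fractional t \<inter> half_open q (closed_alcove x)"
  shows "slack_list t q x y \<in> shifted_compositions (card reps) (card (visible q x)) t"
proof -
  have "real (sum_list (slack_list t q x y) + card (visible q x)) =
      (\<Sum>m<card reps. real (slack_list t q x y ! m) + of_bool (m \<in> visible q x))"
    by (rule sum_nth_add_of_bool_visible[OF length_slack_list, symmetric])
  also have "\<dots> = (\<Sum>m<card reps. real t * bary x y m)"
    by (intro sum.cong) (simp_all add: nth_slack_list[OF assms])
  also have "\<dots> = real t"
    by (simp add: sum_bary[OF x] flip: sum_distrib_left)
  finally show ?thesis
    by (simp add: shifted_compositions_def flip: of_nat_add)
qed

lemma ex_slack_list_eq:
  assumes q: "q \<in> generic" and x: "x \<in> generic" and t: "0 < t"
    and xs: "xs \<in> shifted_compositions (card reps) (card (visible q x)) t"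
  shows "\<exists>y\<in>fractional t \<inter> half_open q (closed_alcove x). slack_list t q x y = xs"
proof -
  have len: "length xs = card reps" and sum: "sum_list xs + card (visible q x) = t"
    using xs by (simp_all add: shifted_compositions_def)
  define w where "w = (\<lambda>m. (real (xs ! m) + of_bool (m \<in> visible q x)) / real t)"
  have "(\<Sum>m<card reps. w m) = 1"
    using t by (simp add: w_def sum_nth_add_of_bool_visible[OF len] sum flip: sum_divide_distrib)
  then obtain y where y: "y \<in> flat" "\<And>m. m < card reps \<Longrightarrow> bary x y m = w m"
    using ex_bary[OF x] by metis
  have "y \<in> fractional t"
    using t by (auto simp: fractional_iff_bary[OF x y(1)] y(2) w_def)
  moreover have "y \<in> half_open q (closed_alcove x)"
    using t by (auto simp: mem_half_open_iff[OF q x y(1)] y(2) w_def visible_def)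
  ultimately have mem: "y \<in> fractional t \<inter> half_open q (closed_alcove x)"
    by blast
  have "slack_list t q x y = xs"
  proof (rule nth_equalityI)
    fix m assume "m < length (slack_list t q x y)"
    then have "m < card reps"
      by simp
    with nth_slack_list[OF q x t mem this] t show "slack_list t q x y ! m = xs ! m"
      by (simp add: y(2) w_def)
  qed (simp add: len)
  with mem show ?thesis by blast
qed

lemma
  assumes q: "q \<in> generic" and F: "F \<in> closed_alcove ` generic" and t: "0 < t"
  shows finite_fractional_half_open: "finite (fractional t \<inter> half_open q F)"
    and card_fractional_half_open: "card (fractional t \<inter> half_open q F) =
      card (shifted_compositions (card reps) (card (arcs_into q F)) t)"
proof -
  obtain x where x: "x \<in> generic" "F = closed_alcove x"
    using F by blast
  have bij: "bij_betw (slack_list t q x) (fractional t \<inter> half_open q F)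
      (shifted_compositions (card reps) (card (arcs_into q F)) t)"
    unfolding x(2) card_arcs_into[OF q x(1)]
  proof (rule bij_betw_imageI[OF inj_on_slack_list[OF q x(1) t]])
    show "slack_list t q x ` (fractional t \<inter> half_open q (closed_alcove x)) =
        shifted_compositions (card reps) (card (visible q x)) t"
      using slack_list_in_shifted_compositions[OF q x(1) t] ex_slack_list_eq[OF q x(1) t] by blast
  qed
  show "finite (fractional t \<inter> half_open q F)"
    using bij_betw_finite[OF bij] finite_shifted_compositions by blast
  show "card (fractional t \<inter> half_open q F) =
      card (shifted_compositions (card reps) (card (arcs_into q F)) t)"
    by (rule bij_betw_same_card[OF bij])
qed

lemma ehrhart_count_0: "ehrhart_count P 0 = 1"
proof -
  have "(\<lambda>x. real 0 *\<^sub>R x) ` P \<inter> {x. \<forall>i. x $ i \<in> \<int>} = {0}"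
    using nonempty by auto
  then show ?thesis
    by (simp add: ehrhart_count_def)
qed

lemma ehrhart_count_pos:
  assumes "0 < t"
  shows "ehrhart_count P t = card (fractional t \<inter> P)"
proof -
  have "(\<lambda>x. real t *\<^sub>R x) ` P \<inter> {x. \<forall>i. x $ i \<in> \<int>} = (\<lambda>x. real t *\<^sub>R x) ` (fractional t \<inter> P)"
    by (auto simp: fractional_def)
  with assms show ?thesis
    by (simp add: ehrhart_count_def card_image inj_on_def)
qed

lemma card_arcs_into_eq_0_iff:
  assumes q: "q \<in> generic" and F: "F \<in> closed_alcove ` generic"
  shows "card (arcs_into q F) = 0 \<longleftrightarrow> F = closed_alcove q"
proof -
  obtain x where x: "x \<in> generic" "F = closed_alcove x"
    using F by blast
  have "finite (visible q x)"
    using visible_subset finite_subset by blast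
  then show ?thesis
    using visible_empty_iff[OF q x(1)] by (simp add: x(2) card_arcs_into[OF q x(1)])
qed

lemma ehrhart_count_eq:
  assumes q: "q \<in> generic"
  shows "ehrhart_count P t =
    (\<Sum>F\<in>closed_alcove ` generic. card (shifted_compositions (card reps) (card (arcs_into q F)) t))"
    (is "_ = (\<Sum>F\<in>?\<Delta>. ?count F)")
proof (cases "t = 0")
  case True
  have "?count F = (if F = closed_alcove q then 1 else 0)" if "F \<in> ?\<Delta>" for F
    unfolding card_shifted_compositions using card_arcs_into_eq_0_iff[OF q that] True by simp
  then have "(\<Sum>F\<in>?\<Delta>. ?count F) = 1"
    using q finite_alcoved_triangulation by (simp cong: sum.cong)
  then show ?thesis
    by (simp only: True ehrhart_count_0)
next
  case False
  then have t: "0 < t" by simp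
  have "ehrhart_count P t = card (fractional t \<inter> P)"
    by (rule ehrhart_count_pos[OF t])
  also have "fractional t \<inter> P = (\<Union>F\<in>?\<Delta>. fractional t \<inter> half_open q F)"
    using Union_half_open[OF q] by blast
  also have "card \<dots> = (\<Sum>F\<in>?\<Delta>. card (fractional t \<inter> half_open q F))"
  proof (rule card_UN_disjoint[OF finite_alcoved_triangulation])
    show "\<forall>F\<in>?\<Delta>. finite (fractional t \<inter> half_open q F)"
      using finite_fractional_half_open[OF q _ t] by blast
    show "\<forall>F\<in>?\<Delta>. \<forall>G\<in>?\<Delta>. F \<noteq> G \<longrightarrow>
        fractional t \<inter> half_open q F \<inter> (fractional t \<inter> half_open q G) = {}"
      using half_open_disjoint[OF q] by blast
  qed
  also have "\<dots> = (\<Sum>F\<in>?\<Delta>. ?count F)"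
    by (intro sum.cong refl card_fractional_half_open[OF q _ t])
  finally show ?thesis .
qed

lemma h_star_eq:
  assumes q: "q \<in> generic"
  shows "h_star P k = int (card {F \<in> closed_alcove ` generic. card (arcs_into q F) = k})"
proof -
  let ?\<Delta> = "closed_alcove ` generic"
  have dim: "nat (aff_dim P) + 1 = card reps"
    using aff_dim_P[OF q] aff_dim_flat card_reps_pos by linarith
  have "ehrhart_series P = (\<Sum>F\<in>?\<Delta>. Abs_fps (\<lambda>t.
      of_nat (card (shifted_compositions (card reps) (card (arcs_into q F)) t))))"
    by (rule fps_ext) (simp add: ehrhart_series_def ehrhart_count_eq[OF q] fps_sum_nth)
  then have "ehrhart_series P * (1 - fps_X) ^ card reps = (\<Sum>F\<in>?\<Delta>. fps_X ^ card (arcs_into q F))"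
    by (simp add: sum_distrib_right fps_card_shifted_compositions)
  then have "h_star P k = (\<Sum>F\<in>?\<Delta>. if card (arcs_into q F) = k then 1 else 0)"
    unfolding h_star_def dim
    by (simp add: fps_sum_nth fps_X_power_nth eq_commute cong: if_cong)
  also have "\<dots> = int (card {F \<in> ?\<Delta>. card (arcs_into q F) = k})"
    using finite_alcoved_triangulation by (simp add: sum.If_cases Int_def)
  finally show ?thesis .
qed

end

theorem theorem2p6:
  fixes P F\<^sub>0 :: "(real ^ 'n) set" and k :: nat
  assumes "alcoved P"
    and "F\<^sub>0 \<in> alcoved_triangulation P"
  shows "h_star P k =
    int (card {F \<in> alcoved_triangulation P.
      card (incoming_arcs (orientation_away (dual_graph (alcoved_triangulation P)) F\<^sub>0) F) = k})"
proof -
  interpret alcoved_polytope P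
    using assms by unfold_locales (auto simp: alcoved_triangulation_def)
  obtain q where "q \<in> generic" "F\<^sub>0 = closed_alcove q"
    using assms(2) by (auto simp: alcoved_triangulation_eq)
  then show ?thesis
    by (simp add: h_star_eq alcoved_triangulation_eq arcs_into_def)
qed

end
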